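(* The number of clique trees of a $k$-tree $G$ with $n$ vertices and $m$ edges can be determined in linear time, i.e., in $O(n+m)$ operations.
   Context: A $k$-tree: $K_{k+1}$ is a $k$-tree, and adding to a $k$-tree a new vertex adjacent exactly to the vertices of a $k$-clique gives a $k$-tree. The clique-intersection graph of a connected chordal graph $G$ has the maximal cliques of $G$ as vertices, edges between intersecting maximal cliques, weighted by $|Q\cap Q'|$; a clique tree of $G$ is a maximum-weight spanning tree of the clique-intersection graph. *)

theory Defs
  imports Main
begin

section \<open>Graphs, k-trees and clique trees\<close>

text \<open>A finite simple graph is a vertex set \<open>V\<close> with a set \<open>E\<close> of two-element subsets of \<open>V\<close>.\<close>

definition all_edges :: "'a set \<Rightarrow> 'a set set" where
  "all_edges V = {{u, v} | u v. u \<in> V \<and> v \<in> V \<and> u \<noteq> v}"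

definition clique :: "'a set \<Rightarrow> 'a set set \<Rightarrow> 'a set \<Rightarrow> bool" where
  "clique V E Q \<longleftrightarrow> Q \<subseteq> V \<and> (\<forall>u\<in>Q. \<forall>v\<in>Q. u \<noteq> v \<longrightarrow> {u, v} \<in> E)"

inductive k_tree :: "nat \<Rightarrow> 'a set \<Rightarrow> 'a set set \<Rightarrow> bool" for k :: nat where
  complete: "finite V \<Longrightarrow> card V = k + 1 \<Longrightarrow> k_tree k V (all_edges V)"
| extend: "k_tree k V E \<Longrightarrow> clique V E C \<Longrightarrow> card C = k \<Longrightarrow> v \<notin> V \<Longrightarrow>
    k_tree k (insert v V) (E \<union> {{u, v} | u. u \<in> C})"

definition max_cliques :: "'a set \<Rightarrow> 'a set set \<Rightarrow> 'a set set" where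
  "max_cliques V E = {Q. clique V E Q \<and> (\<forall>Q'. clique V E Q' \<and> Q \<subseteq> Q' \<longrightarrow> Q' = Q)}"

definition clique_intersection_edges :: "'a set \<Rightarrow> 'a set set \<Rightarrow> 'a set set set" where
  "clique_intersection_edges V E =
    {{Q, Q'} | Q Q'. Q \<in> max_cliques V E \<and> Q' \<in> max_cliques V E \<and> Q \<noteq> Q' \<and> Q \<inter> Q' \<noteq> {}}"

text \<open>For an edge \<open>e = {Q, Q'}\<close> of the clique-intersection graph, \<open>\<Inter>e = Q \<inter> Q'\<close>.\<close>

definition clique_weight :: "'a set set \<Rightarrow> nat" where
  "clique_weight e = card (\<Inter>e)"

definition connected_graph :: "'a set \<Rightarrow> 'a set set \<Rightarrow> bool" where
  "connected_graph V E \<longleftrightarrow>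
    V \<noteq> {} \<and> (\<forall>u\<in>V. \<forall>v\<in>V. (u, v) \<in> {(x, y). x \<in> V \<and> y \<in> V \<and> {x, y} \<in> E}\<^sup>*)"

text \<open>A cycle is given by the list of its at least three distinct vertices in cyclic order.\<close>

definition graph_cycle :: "'a set set \<Rightarrow> 'a list \<Rightarrow> bool" where
  "graph_cycle E xs \<longleftrightarrow> length xs \<ge> 3 \<and> distinct xs \<and>
    (\<forall>i<length xs. {xs ! i, xs ! ((i + 1) mod length xs)} \<in> E)"

definition spanning_tree :: "'a set \<Rightarrow> 'a set set \<Rightarrow> 'a set set \<Rightarrow> bool" where
  "spanning_tree V E T \<longleftrightarrow> T \<subseteq> E \<and> connected_graph V T \<and> (\<nexists>xs. graph_cycle T xs)"

definition max_weight_spanning_tree ::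
    "'a set \<Rightarrow> 'a set set \<Rightarrow> ('a set \<Rightarrow> nat) \<Rightarrow> 'a set set \<Rightarrow> bool" where
  "max_weight_spanning_tree V E w T \<longleftrightarrow> spanning_tree V E T \<and>
    (\<forall>T'. spanning_tree V E T' \<longrightarrow> (\<Sum>e\<in>T'. w e) \<le> (\<Sum>e\<in>T. w e))"

definition clique_trees :: "'a set \<Rightarrow> 'a set set \<Rightarrow> 'a set set set set" where
  "clique_trees V E =
    {T. max_weight_spanning_tree (max_cliques V E) (clique_intersection_edges V E) clique_weight T}"


section \<open>Uniform-cost random access machine\<close>

text \<open>
  Programs are structured programs over finitely many arrays of natural numbers with computed
  indices; a scalar variable is cell 0 of an array. Merging the arrays used by a program into a
  single memory by interleaving changes the running time by a constant factor only.
  Under the uniform cost criterion, every constant, memory access, arithmetic operation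
  (addition, truncated subtraction, multiplication), comparison, Boolean connective and control
  step counts as one operation. Multiplication of unbounded numbers has to be a single
  operation here: in general the number of clique trees of a k-tree with n vertices has more
  than linearly many bits.
\<close>

type_synonym state = "nat \<Rightarrow> nat \<Rightarrow> nat"

datatype aexp =
    Const nat
  | Cell nat aexp
  | Plus aexp aexp
  | Minus aexp aexp
  | Times aexp aexp

datatype bexp =
    Less aexp aexp
  | Equal aexp aexp
  | Neg bexp
  | Conj bexp bexp

datatype com =
    Skip
  | Assign nat aexp aexp
  | Seq com com
  | Cond bexp com com
  | While bexp com

fun aval :: "aexp \<Rightarrow> state \<Rightarrow> nat" where
  "aval (Const c) s = c"
| "aval (Cell x a) s = s x (aval a s)"
| "aval (Plus a b) s = aval a s + aval b s"
| "aval (Minus a b) s = aval a s - aval b s"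
| "aval (Times a b) s = aval a s * aval b s"

fun acost :: "aexp \<Rightarrow> nat" where
  "acost (Const c) = 1"
| "acost (Cell x a) = acost a + 1"
| "acost (Plus a b) = acost a + acost b + 1"
| "acost (Minus a b) = acost a + acost b + 1"
| "acost (Times a b) = acost a + acost b + 1"

fun bval :: "bexp \<Rightarrow> state \<Rightarrow> bool" where
  "bval (Less a b) s = (aval a s < aval b s)"
| "bval (Equal a b) s = (aval a s = aval b s)"
| "bval (Neg b) s = (\<not> bval b s)"
| "bval (Conj b c) s = (bval b s \<and> bval c s)"

fun bcost :: "bexp \<Rightarrow> nat" where
  "bcost (Less a b) = acost a + acost b + 1"
| "bcost (Equal a b) = acost a + acost b + 1"
| "bcost (Neg b) = bcost b + 1"
| "bcost (Conj b c) = bcost b + bcost c + 1"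

text \<open>
  \<open>exec p s t s'\<close>: started in state \<open>s\<close>, program \<open>p\<close> halts in state \<open>s'\<close> after \<open>t\<close> operations.
  \<open>Assign x a b\<close> stores the value of \<open>b\<close> in the cell of array \<open>x\<close> whose index is the value of \<open>a\<close>.
\<close>

inductive exec :: "com \<Rightarrow> state \<Rightarrow> nat \<Rightarrow> state \<Rightarrow> bool" where
  Skip: "exec Skip s 1 s"
| Assign: "exec (Assign x a b) s (acost a + acost b + 1) (s(x := (s x)(aval a s := aval b s)))"
| Seq: "exec p s t s' \<Longrightarrow> exec q s' t' s'' \<Longrightarrow> exec (Seq p q) s (t + t') s''"
| CondTrue: "bval b s \<Longrightarrow> exec p s t s' \<Longrightarrow> exec (Cond b p q) s (bcost b + 1 + t) s'"
| CondFalse: "\<not> bval b s \<Longrightarrow> exec q s t s' \<Longrightarrow> exec (Cond b p q) s (bcost b + 1 + t) s'"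
| WhileFalse: "\<not> bval b s \<Longrightarrow> exec (While b p) s (bcost b + 1) s"
| WhileTrue: "bval b s \<Longrightarrow> exec p s t s' \<Longrightarrow> exec (While b p) s' t' s'' \<Longrightarrow>
    exec (While b p) s (bcost b + 1 + t + t') s''"

lemma exec_deterministic:
  "exec p s t s' \<Longrightarrow> exec p s u s'' \<Longrightarrow> t = u \<and> s' = s''"
proof (induction arbitrary: u s'' rule: exec.induct)
  case (Skip s) then show ?case by (auto elim: exec.cases)
next
  case (Assign x a b s) then show ?case by (auto elim: exec.cases)
next
  case (Seq p s t s' q t' s2)
  from Seq.prems show ?case by cases (use Seq.IH in blast)
next
  case (CondTrue b s p t s' q)
  from CondTrue.prems show ?case by cases (use CondTrue in blast)+
next
  case (CondFalse b s q t s' p)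
  from CondFalse.prems show ?case by cases (use CondFalse in blast)+
next
  case (WhileFalse b s p)
  from WhileFalse.prems show ?case by cases (use WhileFalse in blast)+
next
  case (WhileTrue b s p t s' t' s2)
  from WhileTrue.prems show ?case by cases (use WhileTrue in blast)+
qed


section \<open>Graphs as inputs\<close>

text \<open>
  The input graph has the vertices \<open>0, \<dots>, n - 1\<close> and is given by adjacency lists, each in
  arbitrary order. In memory, array 0 holds \<open>n\<close>, array 2 the concatenation of the adjacency
  lists, and array 1 their offsets: the neighbours of \<open>v\<close> are the cells of array 2 from
  position (array 1, cell \<open>v\<close>) up to, but excluding, position (array 1, cell \<open>v + 1\<close>).
  All other cells are 0. The parameter \<open>k\<close> is not part of the input. The result is returned
  in cell 0 of array 3.
\<close>

definition adjacency_lists :: "nat \<Rightarrow> nat set set \<Rightarrow> nat list list \<Rightarrow> bool" where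
  "adjacency_lists n E adj \<longleftrightarrow> length adj = n \<and>
    (\<forall>v<n. distinct (adj ! v) \<and> set (adj ! v) = {u. {u, v} \<in> E})"

definition input_state :: "nat list list \<Rightarrow> state" where
  "input_state adj = (\<lambda>x i. 0)(
     0 := (\<lambda>i. 0)(0 := length adj),
     1 := (\<lambda>i. if i \<le> length adj then length (concat (take i adj)) else 0),
     2 := (\<lambda>i. if i < length (concat adj) then concat adj ! i else 0))"

definition result :: "state \<Rightarrow> nat" where
  "result s = s 3 0"

end

theory Submission
  imports Defs "HOL-Library.FuncSet" "HOL-Library.Nat_Bijection"
begin

text \<open>
  The maximal cliques of a \<open>k\<close>-tree are its \<open>(k + 1)\<close>-cliques, and two of them share at most \<open>k\<close>
  vertices. The pairs sharing exactly \<open>k\<close> vertices form a connected graph \<open>H\<close>, so the clique trees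
  are the spanning trees of \<open>H\<close>. For a \<open>k\<close>-clique \<open>C\<close>, the maximal cliques containing \<open>C\<close> are
  pairwise adjacent in \<open>H\<close>, and these complete graphs are the blocks of \<open>H\<close>. If \<open>G\<close> is built by attaching
  vertices to \<open>k\<close>-cliques and \<open>c\<close> of them are attached to \<open>C\<close>, then the block of \<open>C\<close> has \<open>c + 1\<close>
  elements; by Cayley's formula the number of clique trees is the product of \<open>(c + 1) ^ (c - 1)\<close> over
  all \<open>C\<close> that are used as attachment cliques.

  Any vertex of degree \<open>k\<close> can be removed from a \<open>k\<close>-tree with more than \<open>k + 1\<close> vertices. Removing
  such vertices with a queue takes linear time and yields the attachment cliques. Each clique is
  represented by its binary code and this number is used as a memory address to count multiplicities.
  No division is needed: every occurrence of \<open>C\<close> except the first contributes a factor \<open>c + 1\<close>.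
\<close>

section \<open>Cayley's formula\<close>

text \<open>The input contains no construction order, so the product must not depend on the order
  that is found. By \<open>k_tree_seq_count\<close> it does not: the multiplicity of a
  \<open>k\<close>-clique is one less than the number of maximal cliques containing it. The queue is
  sound because deleting a vertex of degree \<open>k\<close> leaves a \<open>k\<close>-tree, whose
  degrees are at least \<open>k\<close>; hence, among more than \<open>k + 1\<close> vertices, no
  two of degree \<open>k\<close> are adjacent, and a queued vertex keeps its degree until its turn.
  Connectedness of \<open>H\<close> is not shown directly: Cayley's product is positive, so
  \<open>H\<close> has a spanning tree, and this is what forces every maximum-weight tree into
  \<open>H\<close>. Cayley's formula is proved for forests with several roots, because removing one
  layer of a rooted tree leaves many roots. Powers of two are summed in whatever order an adjacency
  list has, so no sorting is required, and the value 0 doubles as the mark of a removed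
  vertex.\<close>

lemma doubleton_in_all_edges [simp]: "{u, v} \<in> all_edges V \<longleftrightarrow> u \<in> V \<and> v \<in> V \<and> u \<noteq> v"
  by (auto simp: all_edges_def doubleton_eq_iff)

lemma finite_all_edges: "finite V \<Longrightarrow> finite (all_edges V)"
  by (rule finite_subset[of _ "Pow V"]) (auto simp: all_edges_def)

text \<open>The rank \<open>d\<close> expresses that iterating \<open>f\<close> leads from every element of \<open>S\<close> to the roots \<open>R\<close>.\<close>

definition parent_maps :: "'a set \<Rightarrow> 'a set \<Rightarrow> ('a \<Rightarrow> 'a) set" where
  "parent_maps S R = {f \<in> S \<rightarrow>\<^sub>E S \<union> R. \<exists>d :: 'a \<Rightarrow> nat. \<forall>v\<in>S. d (f v) < d v}"

lemma parent_maps_empty_source: "parent_maps {} R = {\<lambda>_. undefined}"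
  by (auto simp: parent_maps_def)

text \<open>An element of least rank would need an image of still smaller rank in
  \<open>S\<close>.\<close>

lemma parent_maps_no_roots:
  assumes "finite S" "S \<noteq> {}"
  shows "parent_maps S {} = {}"
proof -
  { fix f and d :: "'a \<Rightarrow> nat"
    assume f: "f \<in> S \<rightarrow>\<^sub>E S \<union> {}" and d: "\<forall>v\<in>S. d (f v) < d v"
    obtain v where v: "v \<in> S" "\<forall>u\<in>S. d v \<le> d u"
      using assms arg_min_if_finite(1)[of S d] arg_min_least[of S _ d] by blast
    have "f v \<in> S" using f v(1) by auto
    then have False using v d by (meson leD) }
  then show ?thesis unfolding parent_maps_def by blast
qed

lemma finite_parent_maps:
  assumes "finite S" "finite R"
  shows "finite (parent_maps S R)"
proof (rule finite_subset)
  show "parent_maps S R \<subseteq> S \<rightarrow>\<^sub>E S \<union> R" by (auto simp: parent_maps_def)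
  show "finite (S \<rightarrow>\<^sub>E S \<union> R)" using assms by (intro finite_PiE) auto
qed

text \<open>Splits off the layer \<open>N\<close> of vertices mapped directly to a root. They choose
  their roots freely, and \<open>N\<close> takes over the role of the root set for all remaining
  vertices, none of which is mapped to \<open>R\<close>. This is the recursion behind the
  count.\<close>

lemma parent_maps_decompose:
  assumes disj: "S \<inter> R = {}"
  shows "bij_betw (\<lambda>f. let N = {v \<in> S. f v \<in> R} in (N, restrict f N, restrict f (S - N)))
    (parent_maps S R) (SIGMA N:Pow S. (N \<rightarrow>\<^sub>E R) \<times> parent_maps (S - N) N)"
proof (rule bij_betw_byWitness[where f' = "\<lambda>(N, h, g). \<lambda>v. if v \<in> N then h v else g v"],
    goal_cases)
  case 1
  show ?case
    by (auto simp: parent_maps_def Let_def fun_eq_iff PiE_def extensional_def)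
next
  case 2
  show ?case
  proof clarify
    fix N h g assume N: "N \<subseteq> S" and h: "h \<in> N \<rightarrow>\<^sub>E R" and g: "g \<in> parent_maps (S - N) N"
    have g': "g \<in> S - N \<rightarrow>\<^sub>E S" using g N by (auto simp: parent_maps_def PiE_def Pi_def)
    have "{v \<in> S. (if v \<in> N then h v else g v) \<in> R} = N"
      using N h g' disj by (auto simp: PiE_def Pi_def split: if_splits)
    moreover have "restrict (\<lambda>v. if v \<in> N then h v else g v) N = h"
      using h by (auto simp: fun_eq_iff PiE_def extensional_def)
    moreover have "restrict (\<lambda>v. if v \<in> N then h v else g v) (S - N) = g"
      using g' by (auto simp: fun_eq_iff PiE_def extensional_def)
    ultimately show "(let N' = {v \<in> S. (if v \<in> N then h v else g v) \<in> R} in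
       (N', restrict (\<lambda>v. if v \<in> N then h v else g v) N',
        restrict (\<lambda>v. if v \<in> N then h v else g v) (S - N'))) = (N, h, g)"
      by (simp add: Let_def)
  qed
next
  case 3
  show ?case
  proof (rule image_subsetI)
    fix f assume f: "f \<in> parent_maps S R"
    let ?N = "{v \<in> S. f v \<in> R}"
    have "restrict f (S - ?N) \<in> parent_maps (S - ?N) ?N"
    proof -
      obtain d :: "'a \<Rightarrow> nat" where d: "\<forall>v\<in>S. d (f v) < d v"
        using f by (auto simp: parent_maps_def)
      have "\<forall>v\<in>S - ?N. d (restrict f (S - ?N) v) < d v" using d by auto
      moreover have "restrict f (S - ?N) \<in> S - ?N \<rightarrow>\<^sub>E (S - ?N) \<union> ?N"
        using f by (auto simp: parent_maps_def PiE_def Pi_def)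
      ultimately show ?thesis unfolding parent_maps_def by blast
    qed
    then show "(let N = ?N in (N, restrict f N, restrict f (S - N)))
        \<in> (SIGMA N:Pow S. (N \<rightarrow>\<^sub>E R) \<times> parent_maps (S - N) N)"
      by (auto simp: Let_def)
  qed
next
  case 4
  show ?case
  proof clarify
    fix N h g assume N: "N \<subseteq> S" and h: "h \<in> N \<rightarrow>\<^sub>E R" and g: "g \<in> parent_maps (S - N) N"
    let ?f = "\<lambda>v. if v \<in> N then h v else g v"
    have g': "g \<in> S - N \<rightarrow>\<^sub>E S" using g N by (auto simp: parent_maps_def PiE_def Pi_def)
    obtain d :: "'a \<Rightarrow> nat" where d: "\<forall>v\<in>S - N. d (g v) < d v"
      using g by (auto simp: parent_maps_def)
    have "?f \<in> S \<rightarrow>\<^sub>E S \<union> R"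
      using N h g' by (auto simp: PiE_def Pi_def extensional_def)
    \<comment> \<open>The rank of \<open>g\<close> says nothing about \<open>R\<close>, so it is
      raised by one to leave 0 for the roots.\<close>
    moreover have "\<forall>v\<in>S. (if ?f v \<in> R then 0 else d (?f v) + 1) < (if v \<in> R then 0 else d v + 1)"
      using d disj h g' by (auto simp: PiE_def Pi_def)
    ultimately show "?f \<in> parent_maps S R"
      unfolding parent_maps_def
      by (intro CollectI conjI exI[of _ "\<lambda>v. if v \<in> R then 0 else d v + 1"])
  qed
qed

lemma sum_Pow_card:
  fixes f :: "nat \<Rightarrow> nat"
  assumes "finite S"
  shows "(\<Sum>N\<in>Pow S. f (card N)) = (\<Sum>i\<le>card S. (card S choose i) * f i)"
proof -
  have "(\<Sum>N\<in>Pow S. f (card N)) = (\<Sum>i\<le>card S. \<Sum>N\<in>{N \<in> Pow S. card N = i}. f (card N))"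
    using assms by (subst sum.group) (auto intro: card_mono)
  also have "\<dots> = (\<Sum>i\<le>card S. (card S choose i) * f i)"
  proof (intro sum.cong refl)
    fix i
    have "(\<Sum>N\<in>{N \<in> Pow S. card N = i}. f (card N)) = (\<Sum>N\<in>{N \<in> Pow S. card N = i}. f i)"
      by (intro sum.cong) auto
    also have "\<dots> = (card S choose i) * f i"
      using n_subsets[OF assms, of i] by simp
    finally show "(\<Sum>N\<in>{N \<in> Pow S. card N = i}. f (card N)) = (card S choose i) * f i" .
  qed
  finally show ?thesis .
qed

text \<open>The term for \<open>i = 0\<close> vanishes; in the others absorption turns
  \<open>i * (s choose i)\<close> into \<open>s\<close> times a binomial coefficient of
  \<open>s - 1\<close>, and the binomial theorem remains.\<close>

lemma sum_binomial_weighted: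
  fixes r s :: nat
  shows "(\<Sum>i\<le>s. (s choose i) * (i * r ^ i * s ^ (s - i))) = s * (r * (s + r) ^ (s - 1))"
proof (cases s)
  case 0
  then show ?thesis by simp
next
  case (Suc s')
  have "(\<Sum>i\<le>s. (s choose i) * (i * r ^ i * s ^ (s - i)))
      = (\<Sum>i\<le>s'. (Suc s' choose Suc i) * (Suc i * r ^ Suc i * s ^ (s' - i)))"
    unfolding Suc by (subst sum.atMost_Suc_shift) simp
  also have "\<dots> = (\<Sum>i\<le>s'. s * r * ((s' choose i) * r ^ i * s ^ (s' - i)))"
  proof (intro sum.cong refl)
    fix i
    have "(Suc s' choose Suc i) * Suc i = Suc s' * (s' choose i)"
      using Suc_times_binomial[of i s'] by (simp add: mult.commute)
    then have "(Suc s' choose Suc i) * (Suc i * r ^ Suc i * s ^ (s' - i))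
        = Suc s' * (s' choose i) * (r ^ Suc i * s ^ (s' - i))"
      by (metis mult.assoc)
    also have "\<dots> = s * r * ((s' choose i) * r ^ i * s ^ (s' - i))"
      by (simp add: Suc mult_ac del: mult_Suc)
    finally show "(Suc s' choose Suc i) * (Suc i * r ^ Suc i * s ^ (s' - i))
        = s * r * ((s' choose i) * r ^ i * s ^ (s' - i))" .
  qed
  also have "\<dots> = s * r * (r + s) ^ s'"
    by (simp add: sum_distrib_left[symmetric] binomial)
  also have "\<dots> = s * (r * (s + r) ^ (s - 1))"
    by (simp add: Suc add.commute mult.assoc del: mult_Suc)
  finally show ?thesis .
qed

text \<open>Cayley's formula for rooted forests. In the recursion by layers
  \<open>card (S - N) + card N\<close> is always \<open>card S\<close>, so the induction hypothesis
  only produces powers of \<open>card S\<close>.\<close>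

lemma card_parent_maps:
  assumes "finite S" "finite R" "S \<inter> R = {}" "S \<noteq> {}"
  shows "card (parent_maps S R) = card R * (card S + card R) ^ (card S - 1)"
  using assms
proof (induction "card S" arbitrary: S R rule: less_induct)
  case less
  let ?s = "card S" and ?r = "card R"
  have s: "?s > 0" using less.prems by (simp add: card_gt_0_iff)
  \<comment> \<open>Multiplying by \<open>?s\<close> repairs the exponent
    \<open>?s - card N - 1\<close>, which would be -1 for \<open>N = S\<close>. The factor is
    cancelled at the end.\<close>
  have piece: "?s * card (parent_maps (S - N) N) = card N * ?s ^ (?s - card N)" if N: "N \<subseteq> S" for N
  proof -
    have fN: "finite N" using N less.prems(1) finite_subset by blast
    have cN: "card (S - N) = ?s - card N" "card N \<le> ?s"
      using N less.prems(1) fN by (auto simp: card_Diff_subset card_mono)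
    consider "N = {}" | "N = S" | "N \<noteq> {}" "N \<noteq> S" by blast
    then show ?thesis
    proof cases
      case 1
      then show ?thesis using parent_maps_no_roots[OF less.prems(1,4)] by simp
    next
      case 2
      then show ?thesis by (simp add: parent_maps_empty_source)
    next
      case 3
      have lt: "card N < ?s" using 3 N less.prems(1) psubset_card_mono by blast
      have "card N > 0" using 3 fN by (simp add: card_gt_0_iff)
      then have "card (parent_maps (S - N) N) = card N * ?s ^ (?s - card N - 1)"
        using less.hyps[of "S - N" N] cN lt 3 N less.prems(1) fN by auto
      moreover have "?s * ?s ^ (?s - card N - 1) = ?s ^ (?s - card N)"
        using lt by (metis Suc_diff_1 power_Suc zero_less_diff)
      ultimately show ?thesis by (metis mult.left_commute)
    qed
  qed
  have "card (parent_maps S R) = card (SIGMA N:Pow S. (N \<rightarrow>\<^sub>E R) \<times> parent_maps (S - N) N)"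
    using parent_maps_decompose[OF less.prems(3)] by (rule bij_betw_same_card)
  also have "\<dots> = (\<Sum>N\<in>Pow S. card ((N \<rightarrow>\<^sub>E R) \<times> parent_maps (S - N) N))"
    using less.prems(1,2)
    by (intro card_SigmaI)
      (auto intro!: finite_cartesian_product finite_PiE finite_parent_maps dest: finite_subset)
  also have "\<dots> = (\<Sum>N\<in>Pow S. ?r ^ card N * card (parent_maps (S - N) N))"
    using less.prems(1) by (intro sum.cong) (auto simp: card_cartesian_product card_PiE dest: finite_subset)
  finally have "?s * card (parent_maps S R)
      = (\<Sum>N\<in>Pow S. ?r ^ card N * (?s * card (parent_maps (S - N) N)))"
    by (simp add: sum_distrib_left mult_ac)
  also have "\<dots> = (\<Sum>N\<in>Pow S. card N * ?r ^ card N * ?s ^ (?s - card N))"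
    using piece by (intro sum.cong) (auto simp: mult_ac)
  also have "\<dots> = (\<Sum>i\<le>?s. (?s choose i) * (i * ?r ^ i * ?s ^ (?s - i)))"
    using sum_Pow_card[OF less.prems(1), of "\<lambda>i. i * ?r ^ i * ?s ^ (?s - i)"] .
  also have "\<dots> = ?s * (?r * (?s + ?r) ^ (?s - 1))"
    by (rule sum_binomial_weighted)
  finally show ?case using s by simp
qed

section \<open>Trees as parent maps towards a fixed root\<close>

definition adj_rel :: "'a set \<Rightarrow> 'a set set \<Rightarrow> ('a \<times> 'a) set" where
  "adj_rel V E = {(x, y). x \<in> V \<and> y \<in> V \<and> {x, y} \<in> E}"

lemma connected_graph_iff:
  "connected_graph V E \<longleftrightarrow> V \<noteq> {} \<and> (\<forall>u\<in>V. \<forall>v\<in>V. (u, v) \<in> (adj_rel V E)\<^sup>*)"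
  by (simp add: connected_graph_def adj_rel_def)

lemma adj_rel_rtrancl_sym: "(u, v) \<in> (adj_rel V E)\<^sup>* \<Longrightarrow> (v, u) \<in> (adj_rel V E)\<^sup>*"
proof -
  have "sym (adj_rel V E)" by (auto simp: sym_def adj_rel_def insert_commute)
  then show "(u, v) \<in> (adj_rel V E)\<^sup>* \<Longrightarrow> (v, u) \<in> (adj_rel V E)\<^sup>*"
    by (meson sym_rtrancl symD)
qed

lemma connected_graph_from_root:
  assumes "r \<in> V" "\<And>v. v \<in> V \<Longrightarrow> (v, r) \<in> (adj_rel V E)\<^sup>*"
  shows "connected_graph V E"
  unfolding connected_graph_iff
  using assms adj_rel_rtrancl_sym[of _ _ V E] by (metis empty_iff rtrancl_trans)

definition parent_edges :: "'a set \<Rightarrow> ('a \<Rightarrow> 'a) \<Rightarrow> 'a set set" where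
  "parent_edges S f = (\<lambda>v. {v, f v}) ` S"

lemma inj_on_parent_edge:
  fixes d :: "'a \<Rightarrow> nat"
  assumes "\<forall>v\<in>S. d (f v) < d v"
  shows "inj_on (\<lambda>v. {v, f v}) S"
proof (rule inj_onI)
  fix u v assume "u \<in> S" "v \<in> S" "{u, f u} = {v, f v}"
  then show "u = v" using assms by (metis doubleton_eq_iff less_asym)
qed

lemma parent_edges_connected:
  fixes d :: "'a \<Rightarrow> nat"
  assumes r: "r \<in> V" and f: "\<forall>v\<in>V - {r}. f v \<in> V \<and> d (f v) < d v"
  shows "connected_graph V (parent_edges (V - {r}) f)"
proof (rule connected_graph_from_root[OF r])
  fix v assume "v \<in> V"
  then show "(v, r) \<in> (adj_rel V (parent_edges (V - {r}) f))\<^sup>*"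
  proof (induction "d v" arbitrary: v rule: less_induct)
    case less
    show ?case
    proof (cases "v = r")
      case False
      then have "(v, f v) \<in> adj_rel V (parent_edges (V - {r}) f)"
        using less.prems f by (auto simp: adj_rel_def parent_edges_def)
      moreover have "(f v, r) \<in> (adj_rel V (parent_edges (V - {r}) f))\<^sup>*"
        using less False f by auto
      ultimately show ?thesis by (rule converse_rtrancl_into_rtrancl)
    qed simp
  qed
qed

text \<open>Breadth-first search: the rank is the distance to \<open>r\<close>, and every other
  vertex has a neighbour that is closer.\<close>

lemma connected_graph_parent_map:
  assumes conn: "connected_graph V T" and r: "r \<in> V"
  obtains f and d :: "'a \<Rightarrow> nat"
  where "\<forall>v\<in>V - {r}. f v \<in> V \<and> d (f v) < d v" "parent_edges (V - {r}) f \<subseteq> T"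
proof -
  define d where "d v = (LEAST n. (v, r) \<in> adj_rel V T ^^ n)" for v
  have "\<exists>u. u \<in> V \<and> {v, u} \<in> T \<and> d u < d v" if v: "v \<in> V - {r}" for v
  proof -
    have "(v, r) \<in> (adj_rel V T)\<^sup>*" using conn v r by (auto simp: connected_graph_iff)
    then have dv: "(v, r) \<in> adj_rel V T ^^ d v"
      unfolding d_def by (metis LeastI_ex rtrancl_imp_relpow)
    then obtain n where n: "d v = Suc n" using v by (cases "d v") auto
    obtain u where u: "(v, u) \<in> adj_rel V T" "(u, r) \<in> adj_rel V T ^^ n"
      using dv unfolding n by (meson relpow_Suc_D2)
    have "d u \<le> n" unfolding d_def using u(2) by (rule Least_le)
    then show ?thesis using u(1) n by (auto simp: adj_rel_def)
  qed
  then obtain f where f: "\<forall>v\<in>V - {r}. f v \<in> V \<and> {v, f v} \<in> T \<and> d (f v) < d v"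
    by metis
  show ?thesis by (rule that[of f d]) (use f in \<open>auto simp: parent_edges_def\<close>)
qed

text \<open>Counting edges replaces acyclicity because edge numbers add up when graphs are glued;
  \<open>spanning_tree_iff_trees\<close> justifies the exchange.\<close>

definition trees :: "'a set \<Rightarrow> 'a set set \<Rightarrow> 'a set set set" where
  "trees V E = {T. T \<subseteq> E \<and> connected_graph V T \<and> card T = card V - 1}"

lemma connected_graph_card_ge:
  assumes "finite T" "connected_graph V T"
  shows "card V - 1 \<le> card T"
proof -
  obtain r where r: "r \<in> V" using assms by (auto simp: connected_graph_def)
  obtain f and d :: "'a \<Rightarrow> nat"
    where f: "\<forall>v\<in>V - {r}. f v \<in> V \<and> d (f v) < d v" "parent_edges (V - {r}) f \<subseteq> T"
    using connected_graph_parent_map[OF assms(2) r] .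
  have "card (parent_edges (V - {r}) f) = card (V - {r})"
    unfolding parent_edges_def using f(1) by (intro card_image inj_on_parent_edge[of _ d]) auto
  then show ?thesis using card_mono[OF assms(1) f(2)] r by simp
qed

text \<open>The orientation of the edges is forced. If \<open>g\<close> used the edge
  \<open>{v, f v}\<close> in the other direction, then \<open>f v\<close> would be in
  \<open>S\<close> with smaller rank, so by induction \<open>f (f v) = g (f v) = v\<close>, against
  the decrease of \<open>d\<close>.\<close>

lemma parent_map_unique:
  fixes d d' :: "'a \<Rightarrow> nat"
  assumes f: "\<forall>v\<in>S. d (f v) < d v" and g: "\<forall>v\<in>S. d' (g v) < d' v"
    and eq: "parent_edges S f = parent_edges S g" and v: "v \<in> S"
  shows "f v = g v"
  using v
proof (induction "d v" arbitrary: v rule: less_induct)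
  case less
  have "{v, f v} \<in> parent_edges S g" using less.prems eq by (auto simp: parent_edges_def)
  then obtain u where u: "u \<in> S" "{v, f v} = {u, g u}" by (auto simp: parent_edges_def)
  show ?case
  proof (rule ccontr)
    assume "f v \<noteq> g v"
    then have "u = f v" "g u = v" using u(2) by (auto simp: doubleton_eq_iff)
    moreover have "f u = g u" using less.hyps[of u] u(1) f less.prems \<open>u = f v\<close> by auto
    ultimately have "f (f v) = v" "f v \<in> S" using u(1) by auto
    then show False using f less.prems by (metis less_asym)
  qed
qed

text \<open>Orienting a tree towards an arbitrary fixed \<open>r\<close> turns it into a parent map
  with the single root \<open>r\<close>, so the forest count applies with one root.\<close>

theorem cayley_formula:
  assumes fin: "finite V" and ge2: "card V \<ge> 2"
  shows "card (trees V (all_edges V)) = card V ^ (card V - 2)"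
proof -
  obtain r where r: "r \<in> V" using ge2 by fastforce
  have cS: "card (V - {r}) = card V - 1" using fin r by simp
  then have "V - {r} \<noteq> {}" using ge2 by (metis card.empty diff_is_0_eq not_less_eq_eq numeral_2_eq_2 One_nat_def)
  then have S: "finite (V - {r})" "V - {r} \<noteq> {}" "card (V - {r}) = card V - 1"
    using fin cS by auto
  have inV: "(V - {r}) \<union> {r} = V" using r by auto
  have "bij_betw (parent_edges (V - {r})) (parent_maps (V - {r}) {r}) (trees V (all_edges V))"
    unfolding bij_betw_def
  proof
    show "inj_on (parent_edges (V - {r})) (parent_maps (V - {r}) {r})"
    proof (rule inj_onI)
      fix f g assume fg: "f \<in> parent_maps (V - {r}) {r}" "g \<in> parent_maps (V - {r}) {r}"
        and eq: "parent_edges (V - {r}) f = parent_edges (V - {r}) g"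
      show "f = g"
      proof (rule extensionalityI[of _ "V - {r}"])
        show "f \<in> extensional (V - {r})" "g \<in> extensional (V - {r})"
          using fg by (auto simp: parent_maps_def PiE_def)
        fix v assume "v \<in> V - {r}"
        then show "f v = g v"
          using fg eq parent_map_unique[of "V - {r}" _ f _ g] by (auto simp: parent_maps_def)
      qed
    qed
    show "parent_edges (V - {r}) ` parent_maps (V - {r}) {r} = trees V (all_edges V)"
    proof
      show "parent_edges (V - {r}) ` parent_maps (V - {r}) {r} \<subseteq> trees V (all_edges V)"
      proof (rule image_subsetI)
        fix f assume "f \<in> parent_maps (V - {r}) {r}"
        then obtain d :: "'a \<Rightarrow> nat"
          where f: "f \<in> V - {r} \<rightarrow>\<^sub>E V" "\<forall>v\<in>V - {r}. d (f v) < d v"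
          unfolding parent_maps_def inV by auto
        then have f': "\<forall>v\<in>V - {r}. f v \<in> V \<and> d (f v) < d v" by auto
        have "parent_edges (V - {r}) f \<subseteq> all_edges V"
          using f' by (force simp: parent_edges_def)
        moreover have "card (parent_edges (V - {r}) f) = card V - 1"
          unfolding parent_edges_def
          using card_image[OF inj_on_parent_edge[OF f(2)]] S(3) by simp
        ultimately show "parent_edges (V - {r}) f \<in> trees V (all_edges V)"
          using parent_edges_connected[OF r f'] by (simp add: trees_def)
      qed
      show "trees V (all_edges V) \<subseteq> parent_edges (V - {r}) ` parent_maps (V - {r}) {r}"
      proof
        fix T assume "T \<in> trees V (all_edges V)"
        then have T: "T \<subseteq> all_edges V" "connected_graph V T" "card T = card V - 1"
          by (auto simp: trees_def)
        obtain f and d :: "'a \<Rightarrow> nat"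
          where f: "\<forall>v\<in>V - {r}. f v \<in> V \<and> d (f v) < d v" "parent_edges (V - {r}) f \<subseteq> T"
          using connected_graph_parent_map[OF T(2) r] .
        have "card (parent_edges (V - {r}) f) = card T"
          unfolding parent_edges_def T(3) S(3)[symmetric]
          using f(1) by (intro card_image inj_on_parent_edge[of _ d]) auto
        then have "parent_edges (V - {r}) f = T"
          using card_subset_eq[OF _ f(2)] T(1) finite_all_edges[OF fin] finite_subset by blast
        \<comment> \<open>Members of \<open>parent_maps\<close> are extensional; the restriction
          achieves this without changing an edge.\<close>
        moreover have "parent_edges (V - {r}) (restrict f (V - {r})) = parent_edges (V - {r}) f"
          by (auto simp: parent_edges_def)
        moreover have "restrict f (V - {r}) \<in> parent_maps (V - {r}) {r}"
          unfolding parent_maps_def inV using f(1) by (auto intro!: exI[of _ d])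
        ultimately show "T \<in> parent_edges (V - {r}) ` parent_maps (V - {r}) {r}" by blast
      qed
    qed
  qed
  then have "card (trees V (all_edges V)) = card (parent_maps (V - {r}) {r})"
    by (simp add: bij_betw_same_card)
  also have "\<dots> = card V ^ (card V - 2)"
    using card_parent_maps[of "V - {r}" "{r}"] S ge2 by (simp add: numeral_2_eq_2)
  finally show ?thesis .
qed

section \<open>Acyclicity and the number of edges\<close>

lemma rtrancl_adj_rel_distinct_path:
  assumes "(a, b) \<in> (adj_rel V E)\<^sup>*"
  obtains xs where "xs \<noteq> []" "hd xs = a" "last xs = b" "distinct xs"
    "\<forall>i. Suc i < length xs \<longrightarrow> {xs ! i, xs ! Suc i} \<in> E"
proof -
  have "\<exists>xs. xs \<noteq> [] \<and> hd xs = a \<and> last xs = b \<and> distinct xs \<and>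
    (\<forall>i. Suc i < length xs \<longrightarrow> {xs ! i, xs ! Suc i} \<in> E)"
    using assms
  proof (induction rule: converse_rtrancl_induct)
    case base
    show ?case by (rule exI[of _ "[b]"]) auto
  next
    case (step a c)
    then obtain xs where xs: "xs \<noteq> []" "hd xs = c" "last xs = b" "distinct xs"
      "\<forall>i. Suc i < length xs \<longrightarrow> {xs ! i, xs ! Suc i} \<in> E" by blast
    show ?case
    proof (cases "a \<in> set xs")
      \<comment> \<open>If \<open>a\<close> is already on the path, the part before it is a detour
        and is cut off.\<close>
      case True
      then obtain i where i: "i < length xs" "xs ! i = a" by (auto simp: in_set_conv_nth)
      show ?thesis
        by (rule exI[of _ "drop i xs"]) (use xs i in \<open>auto simp: hd_drop_conv_nth\<close>)
    next
      case False
      show ?thesis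
      proof (intro exI[of _ "a # xs"] conjI allI impI)
        fix i assume i: "Suc i < length (a # xs)"
        show "{(a # xs) ! i, (a # xs) ! Suc i} \<in> E"
        proof (cases i)
          case 0
          have "xs ! 0 = c" using xs(1,2) by (simp add: hd_conv_nth)
          then show ?thesis using step(1) 0 by (auto simp: adj_rel_def)
        qed (use xs(5) i in auto)
      qed (use xs False in auto)
    qed
  qed
  then show ?thesis using that by blast
qed

text \<open>An edge outside a breadth-first tree closes a cycle with the tree path between its ends.
  Conversely, deleting an edge of a cycle keeps the graph connected, which leaves too few edges if
  there were only \<open>card V - 1\<close>.\<close>

lemma acyclic_iff_card:
  assumes fin: "finite V" and sub: "T \<subseteq> all_edges V" and conn: "connected_graph V T"
  shows "(\<nexists>xs. graph_cycle T xs) \<longleftrightarrow> card T = card V - 1"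
proof
  obtain r where r: "r \<in> V" using conn by (auto simp: connected_graph_def)
  obtain f and d :: "'a \<Rightarrow> nat"
    where f: "\<forall>v\<in>V - {r}. f v \<in> V \<and> d (f v) < d v" "parent_edges (V - {r}) f \<subseteq> T"
    using connected_graph_parent_map[OF conn r] .
  let ?F = "parent_edges (V - {r}) f"
  have cF: "card ?F = card V - 1"
    unfolding parent_edges_def using f(1) r
    by (subst card_image[OF inj_on_parent_edge[of _ d]]) auto
  assume nocyc: "\<nexists>xs. graph_cycle T xs"
  have "T \<subseteq> ?F"
  proof (rule ccontr)
    assume "\<not> T \<subseteq> ?F"
    then obtain e where e: "e \<in> T" "e \<notin> ?F" by blast
    then obtain a b where ab: "e = {a, b}" "a \<in> V" "b \<in> V" "a \<noteq> b"
      using sub by (auto simp: all_edges_def)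
    have "(a, b) \<in> (adj_rel V ?F)\<^sup>*"
      using parent_edges_connected[OF r f(1)] ab by (auto simp: connected_graph_iff)
    then obtain xs where xs: "xs \<noteq> []" "hd xs = a" "last xs = b" "distinct xs"
      "\<forall>i. Suc i < length xs \<longrightarrow> {xs ! i, xs ! Suc i} \<in> ?F"
      by (rule rtrancl_adj_rel_distinct_path)
    have h: "xs ! 0 = a" "xs ! (length xs - 1) = b"
      using xs(1-3) by (auto simp: hd_conv_nth last_conv_nth)
    have "length xs \<noteq> 1" using h ab(4) by auto
    \<comment> \<open>A path with two vertices would be the edge \<open>e\<close> itself, which is
      not in \<open>?F\<close>.\<close>
    moreover have "length xs \<noteq> 2" using h xs(5) e(2) ab(1) by (auto simp: numeral_2_eq_2)
    moreover have "length xs \<noteq> 0" using xs(1) by simp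
    ultimately have len: "length xs \<ge> 3" by linarith
    have "{xs ! i, xs ! ((i + 1) mod length xs)} \<in> T" if "i < length xs" for i
    proof (cases "Suc i < length xs")
      case True
      then show ?thesis using xs(5) f(2) by auto
    next
      case False
      then have "i = length xs - 1" "Suc i = length xs" using that by auto
      then show ?thesis using h e(1) ab(1) by (simp add: insert_commute)
    qed
    then have "graph_cycle T xs" using len xs(4) by (simp add: graph_cycle_def)
    then show False using nocyc by blast
  qed
  then show "card T = card V - 1" using f(2) cF by (metis subset_antisym)
next
  have finT: "finite T" using sub finite_all_edges[OF fin] finite_subset by blast
  assume cT: "card T = card V - 1"
  show "\<nexists>xs. graph_cycle T xs"
  proof
    assume "\<exists>xs. graph_cycle T xs"
    then obtain xs where xs: "length xs \<ge> 3" "distinct xs"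
      "\<And>i. i < length xs \<Longrightarrow> {xs ! i, xs ! ((i + 1) mod length xs)} \<in> T"
      by (auto simp: graph_cycle_def)
    define l where "l = length xs - 1"
    have l: "l \<ge> 2" "length xs = Suc l" using xs(1) by (auto simp: l_def)
    \<comment> \<open>The closing edge is deleted; the rest of the cycle still joins its
      ends.\<close>
    let ?e = "{xs ! l, xs ! 0}"
    have e: "?e \<in> T" using xs(3)[of l] l by simp
    have step: "{xs ! i, xs ! Suc i} \<in> T - {?e}" if "i < l" for i
    proof -
      have "{xs ! i, xs ! Suc i} \<in> T" using xs(3)[of i] l that by simp
      moreover have "{xs ! i, xs ! Suc i} \<noteq> ?e"
        using that l xs(2) by (auto simp: doubleton_eq_iff nth_eq_iff_index_eq)
      ultimately show ?thesis by simp
    qed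
    have path: "(xs ! 0, xs ! i) \<in> (adj_rel V (T - {?e}))\<^sup>*" if "i \<le> l" for i
      using that
    proof (induction i)
      case (Suc i)
      have "{xs ! i, xs ! Suc i} \<in> all_edges V"
        using step[of i] Suc.prems sub by (meson DiffD1 Suc_le_eq subsetD)
      then have "(xs ! i, xs ! Suc i) \<in> adj_rel V (T - {?e})"
        using step[of i] Suc.prems unfolding adj_rel_def doubleton_in_all_edges by simp
      then show ?case using Suc by (meson Suc_leD rtrancl.rtrancl_into_rtrancl)
    qed simp
    have "adj_rel V T \<subseteq> (adj_rel V (T - {?e}))\<^sup>*"
    proof
      fix p assume p: "p \<in> adj_rel V T"
      obtain x y where xy: "p = (x, y)" by fastforce
      show "p \<in> (adj_rel V (T - {?e}))\<^sup>*"
      proof (cases "{x, y} = ?e")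
        case True
        then show ?thesis
          using path[of l] adj_rel_rtrancl_sym[OF path[of l]] xy by (auto simp: doubleton_eq_iff)
      next
        case False
        then show ?thesis using p xy by (auto simp: adj_rel_def)
      qed
    qed
    then have "(adj_rel V T)\<^sup>* \<subseteq> (adj_rel V (T - {?e}))\<^sup>*"
      by (rule rtrancl_subset_rtrancl)
    then have "connected_graph V (T - {?e})"
      using conn unfolding connected_graph_iff by blast
    then have "card V - 1 \<le> card (T - {?e})" using connected_graph_card_ge finT by blast
    moreover have "card (T - {?e}) < card T" using e finT by (rule card_Diff1_less[rotated])
    ultimately show False using cT by simp
  qed
qed

lemma spanning_tree_iff_trees:
  assumes "finite V" "E \<subseteq> all_edges V"
  shows "spanning_tree V E T \<longleftrightarrow> T \<in> trees V E"
  using acyclic_iff_card[of V T] assms by (auto simp: spanning_tree_def trees_def)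

section \<open>Spanning trees of graphs whose blocks are complete\<close>

lemma connected_graph_glue_iff:
  assumes x: "W1 \<inter> W2 = {x}" and T1: "T1 \<subseteq> all_edges W1" and T2: "T2 \<subseteq> all_edges W2"
  shows "connected_graph (W1 \<union> W2) (T1 \<union> T2) \<longleftrightarrow> connected_graph W1 T1 \<and> connected_graph W2 T2"
proof
  assume c: "connected_graph W1 T1 \<and> connected_graph W2 T2"
  have sub: "adj_rel W1 T1 \<subseteq> adj_rel (W1 \<union> W2) (T1 \<union> T2)" "adj_rel W2 T2 \<subseteq> adj_rel (W1 \<union> W2) (T1 \<union> T2)"
    by (auto simp: adj_rel_def)
  show "connected_graph (W1 \<union> W2) (T1 \<union> T2)"
  proof (rule connected_graph_from_root[of x])
    show "x \<in> W1 \<union> W2" using x by auto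
    fix v assume "v \<in> W1 \<union> W2"
    then have "(v, x) \<in> (adj_rel W1 T1)\<^sup>* \<or> (v, x) \<in> (adj_rel W2 T2)\<^sup>*"
      using c x unfolding connected_graph_iff by blast
    then show "(v, x) \<in> (adj_rel (W1 \<union> W2) (T1 \<union> T2))\<^sup>*"
      using rtrancl_mono[OF sub(1)] rtrancl_mono[OF sub(2)] by blast
  qed
next
  \<comment> \<open>Collapsing the other side to the cut vertex maps paths to paths.\<close>
  have side: "connected_graph A S"
    if conn: "connected_graph (A \<union> B) (S \<union> S')" and x: "A \<inter> B = {x}" and S': "S' \<subseteq> all_edges B"
      and S: "S \<subseteq> all_edges A" for A B :: "'a set" and S S'
    unfolding connected_graph_iff
  proof (intro conjI ballI)
    show "A \<noteq> {}" using x by auto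
    define h where "h w = (if w \<in> A then w else x)" for w
    have map: "(h u, h v) \<in> (adj_rel A S)\<^sup>*" if "(u, v) \<in> (adj_rel (A \<union> B) (S \<union> S'))\<^sup>*" for u v
      using that
    proof (induction rule: rtrancl_induct)
      case (step y z)
      have "{y, z} \<in> S \<or> {y, z} \<in> S'" using step(2) by (auto simp: adj_rel_def)
      then have "(h y, h z) \<in> (adj_rel A S)\<^sup>*"
      proof
        assume "{y, z} \<in> S"
        moreover have "y \<in> A" "z \<in> A" using calculation S doubleton_in_all_edges[of y z A] by blast+
        ultimately show ?thesis by (auto simp: h_def adj_rel_def)
      next
        assume "{y, z} \<in> S'"
        then have "y \<in> B" "z \<in> B" using S' doubleton_in_all_edges[of y z B] by blast+
        then have "h y = x" "h z = x" using x by (auto simp: h_def)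
        then show ?thesis by simp
      qed
      then show ?case using step.IH by (rule rtrancl_trans[rotated])
    qed simp
    fix u v assume "u \<in> A" "v \<in> A"
    then show "(u, v) \<in> (adj_rel A S)\<^sup>*"
      using map[of u v] conn by (auto simp: connected_graph_iff h_def)
  qed
  assume "connected_graph (W1 \<union> W2) (T1 \<union> T2)"
  then show "connected_graph W1 T1 \<and> connected_graph W2 T2"
    using side[of W1 W2 T1 T2] side[of W2 W1 T2 T1] x T1 T2
    by (simp add: Un_commute[of W2 W1] Un_commute[of T2 T1] Int_commute[of W2 W1])
qed

text \<open>The two sides share no edge, since they share only one vertex. A spanning tree of the
  union is therefore the same as a pair of spanning trees.\<close>

lemma trees_glue:
  assumes fin: "finite W1" "finite W2" and x: "W1 \<inter> W2 = {x}"
    and E1: "E1 \<subseteq> all_edges W1" and E2: "E2 \<subseteq> all_edges W2"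
  shows "card (trees (W1 \<union> W2) (E1 \<union> E2)) = card (trees W1 E1) * card (trees W2 E2)"
proof -
  have disj: "E1 \<inter> E2 = {}"
  proof -
    have "all_edges W1 \<inter> all_edges W2 = {}"
    proof (rule ccontr)
      assume "all_edges W1 \<inter> all_edges W2 \<noteq> {}"
      then obtain e where e: "e \<in> all_edges W1" "e \<in> all_edges W2" by blast
      then obtain u v where "e = {u, v}" by (auto simp: all_edges_def)
      then have "u \<noteq> v" "u \<in> W1 \<inter> W2" "v \<in> W1 \<inter> W2" using e by simp_all
      then show False using x by auto
    qed
    then show ?thesis using E1 E2 by blast
  qed
  have finE: "finite E1" "finite E2"
    by (rule finite_subset[OF E1 finite_all_edges[OF fin(1)]],
        rule finite_subset[OF E2 finite_all_edges[OF fin(2)]])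
  have "x \<in> W1" "x \<in> W2" using x by auto
  then have "0 < card W1" "0 < card W2" using fin by (auto simp: card_gt_0_iff)
  moreover have "card (W1 \<union> W2) + 1 = card W1 + card W2" using card_Un_Int[OF fin] x by simp
  ultimately have cW: "card (W1 \<union> W2) - 1 = (card W1 - 1) + (card W2 - 1)" by linarith
  have iff: "T1 \<union> T2 \<in> trees (W1 \<union> W2) (E1 \<union> E2) \<longleftrightarrow> T1 \<in> trees W1 E1 \<and> T2 \<in> trees W2 E2"
    if T: "T1 \<subseteq> E1" "T2 \<subseteq> E2" for T1 T2
  proof -
    have c: "card (T1 \<union> T2) = card T1 + card T2"
      using T disj finE by (intro card_Un_disjoint) (auto dest: finite_subset)
    have conn: "connected_graph (W1 \<union> W2) (T1 \<union> T2) \<longleftrightarrow> connected_graph W1 T1 \<and> connected_graph W2 T2"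
      using connected_graph_glue_iff[OF x] T E1 E2 by blast
    \<comment> \<open>Connectedness gives a lower bound on each side; as the total is the sum of the
      two bounds, both are attained.\<close>
    have "card W1 - 1 \<le> card T1 \<and> card W2 - 1 \<le> card T2"
      if "connected_graph W1 T1 \<and> connected_graph W2 T2"
      using that connected_graph_card_ge[of T1 W1] connected_graph_card_ge[of T2 W2]
        finite_subset[OF T(1) finE(1)] finite_subset[OF T(2) finE(2)] by simp
    moreover have "T1 \<union> T2 \<subseteq> E1 \<union> E2" using T by (rule Un_mono)
    ultimately show ?thesis unfolding trees_def mem_Collect_eq c conn cW using T by linarith
  qed
  have "bij_betw (\<lambda>(T1, T2). T1 \<union> T2) (trees W1 E1 \<times> trees W2 E2) (trees (W1 \<union> W2) (E1 \<union> E2))"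
  proof (rule bij_betw_byWitness[where f' = "\<lambda>T. (T \<inter> E1, T \<inter> E2)"])
    show "\<forall>a\<in>trees W1 E1 \<times> trees W2 E2.
        (\<lambda>T. (T \<inter> E1, T \<inter> E2)) ((\<lambda>(T1, T2). T1 \<union> T2) a) = a"
      using disj by (auto simp: trees_def)
    show "\<forall>T\<in>trees (W1 \<union> W2) (E1 \<union> E2). (\<lambda>(T1, T2). T1 \<union> T2) (T \<inter> E1, T \<inter> E2) = T"
      by (auto simp: trees_def)
    show "(\<lambda>(T1, T2). T1 \<union> T2) ` (trees W1 E1 \<times> trees W2 E2) \<subseteq> trees (W1 \<union> W2) (E1 \<union> E2)"
    proof clarify
      fix T1 T2 assume T: "T1 \<in> trees W1 E1" "T2 \<in> trees W2 E2"
      then show "T1 \<union> T2 \<in> trees (W1 \<union> W2) (E1 \<union> E2)"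
        using iff[of T1 T2] by (auto simp: trees_def)
    qed
    show "(\<lambda>T. (T \<inter> E1, T \<inter> E2)) ` trees (W1 \<union> W2) (E1 \<union> E2) \<subseteq> trees W1 E1 \<times> trees W2 E2"
    proof (rule image_subsetI)
      fix T assume T: "T \<in> trees (W1 \<union> W2) (E1 \<union> E2)"
      then have "(T \<inter> E1) \<union> (T \<inter> E2) = T" by (auto simp: trees_def)
      then show "(T \<inter> E1, T \<inter> E2) \<in> trees W1 E1 \<times> trees W2 E2"
        using iff[of "T \<inter> E1" "T \<inter> E2"] T by auto
    qed
  qed
  then show ?thesis
    by (simp add: bij_betw_same_card[symmetric] card_cartesian_product)
qed

text \<open>
  Whole blocks are attached at a cut vertex, which makes the number of spanning trees multiplicative;
  the growth of a block by a single vertex is recovered in \<open>block_tree_enlarge_block\<close>.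
\<close>

inductive block_tree :: "'b set \<Rightarrow> 'i set \<Rightarrow> ('i \<Rightarrow> 'b set) \<Rightarrow> bool" where
  single: "block_tree {x} {} B"
| attach: "block_tree W I B \<Longrightarrow> x \<in> W \<Longrightarrow> finite N \<Longrightarrow> N \<noteq> {} \<Longrightarrow> N \<inter> W = {} \<Longrightarrow> i \<notin> I \<Longrightarrow>
    \<forall>j\<in>I. B' j = B j \<Longrightarrow> B' i = insert x N \<Longrightarrow> block_tree (W \<union> N) (insert i I) B'"

lemma block_tree_finite: "block_tree W I B \<Longrightarrow> finite W \<and> finite I"
  by (induction rule: block_tree.induct) auto

lemma block_tree_block_subset: "block_tree W I B \<Longrightarrow> i \<in> I \<Longrightarrow> B i \<subseteq> W"
  by (induction rule: block_tree.induct) auto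

text \<open>The construction is replayed with \<open>q\<close> added to the vertices that come with
  block \<open>i\<close>. All other attachments stay as they were, at the same cut vertices.\<close>

lemma block_tree_enlarge_block:
  assumes "block_tree W I B" "i \<in> I" "q \<notin> W" "\<forall>j\<in>I - {i}. B' j = B j" "B' i = insert q (B i)"
  shows "block_tree (insert q W) I B'"
  using assms
proof (induction arbitrary: B' rule: block_tree.induct)
  case (single x B)
  then show ?case by simp
next
  case (attach W I B x N l B1 B')
  show ?case
  proof (cases "i = l")
    case True
    have "block_tree (W \<union> insert q N) (insert l I) B'"
      by (rule block_tree.attach[OF attach.hyps(1,2), of "insert q N"]) (use attach True in auto)
    then show ?thesis by simp
  next
    case False
    have "block_tree (insert q W) I B'"
      by (rule attach.IH) (use attach.prems attach.hyps False in auto)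
    then have "block_tree (insert q W \<union> N) (insert l I) B'"
      by (rule block_tree.attach[of _ _ B' x]) (use attach False in auto)
    then show ?thesis by simp
  qed
qed

text \<open>Each attachment multiplies the count by Cayley's number for the new block, which has at
  least two elements because \<open>N\<close> is nonempty.\<close>

lemma card_trees_block_tree:
  assumes "block_tree W I B"
  shows "card (trees W (\<Union>i\<in>I. all_edges (B i))) = (\<Prod>i\<in>I. card (B i) ^ (card (B i) - 2))"
  using assms
proof (induction rule: block_tree.induct)
  case (single x B)
  have "trees {x} {} = {{} :: 'a set set}" by (auto simp: trees_def connected_graph_def)
  then show ?case by simp
next
  case (attach W I B x N i B')
  have fin: "finite W" "finite I" "finite N"
    using attach.hyps block_tree_finite by blast+
  have "card (insert x N) \<ge> 2"
  proof -
    have "x \<notin> N" using attach.hyps by auto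
    moreover have "card N > 0" using attach.hyps by (simp add: card_gt_0_iff)
    ultimately show ?thesis using fin by simp
  qed
  then have cayley: "card (trees (B' i) (all_edges (B' i))) = card (B' i) ^ (card (B' i) - 2)"
    using cayley_formula[of "insert x N"] attach.hyps fin by simp
  have "(\<Union>j\<in>I. all_edges (B j)) \<subseteq> all_edges W"
    using block_tree_block_subset[OF attach.hyps(1)] by (fastforce simp: all_edges_def)
  then have "card (trees (W \<union> B' i) ((\<Union>j\<in>I. all_edges (B j)) \<union> all_edges (B' i)))
      = card (trees W (\<Union>j\<in>I. all_edges (B j))) * card (trees (B' i) (all_edges (B' i)))"
    using attach.hyps fin by (intro trees_glue[of _ _ x]) auto
  moreover have "W \<union> B' i = W \<union> N" using attach.hyps by auto
  moreover have "(\<Union>j\<in>insert i I. all_edges (B' j)) = (\<Union>j\<in>I. all_edges (B j)) \<union> all_edges (B' i)"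
    using attach.hyps by auto
  moreover have "(\<Prod>j\<in>insert i I. card (B' j) ^ (card (B' j) - 2))
      = card (B' i) ^ (card (B' i) - 2) * (\<Prod>j\<in>I. card (B j) ^ (card (B j) - 2))"
    using attach.hyps fin by (subst prod.insert) (auto intro!: prod.cong)
  ultimately show ?case using attach.IH cayley by (simp add: mult.commute)
qed

section \<open>Structure of k-trees\<close>

lemma k_tree_basic:
  assumes "k_tree k V E"
  shows "finite V" "E \<subseteq> all_edges V" "k + 1 \<le> card V"
  using assms
proof (induction rule: k_tree.induct)
  case (extend V E C v)
  { case 1 show ?case using extend by simp
  next
    case 2 show ?case using extend unfolding all_edges_def clique_def by fast
  next
    case 3 show ?case using extend by simp }
qed auto

lemma k_tree_minimal_complete:
  assumes "k_tree k V E" "card V = k + 1"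
  shows "E = all_edges V"
  using assms
proof cases
  case (extend V' E' C v)
  then have "card V = Suc (card V')" using k_tree_basic(1)[of k V' E'] by simp
  then show ?thesis using k_tree_basic(3)[of k V' E'] extend assms(2) by simp
qed auto

text \<open>A clique through \<open>v\<close> lies in \<open>v\<close> and its neighbourhood
  \<open>C\<close>, every such set is a clique because \<open>C\<close> is one, and no edge appears
  between old vertices. The inductions about cliques below rest on this.\<close>

lemma clique_extend_iff:
  assumes E: "E \<subseteq> all_edges V" and C: "clique V E C" and v: "v \<notin> V"
  shows "clique (insert v V) (E \<union> {{u, v} | u. u \<in> C}) Q \<longleftrightarrow>
    (v \<in> Q \<and> Q \<subseteq> insert v C) \<or> clique V E Q"
proof -
  define F where "F = E \<union> {{u, v} | u. u \<in> C}"
  have nb: "{u, v} \<in> F \<longleftrightarrow> u \<in> C" if "u \<noteq> v" for u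
    using E v that C unfolding F_def by (auto simp: doubleton_eq_iff clique_def)
  have old: "{u, w} \<in> F \<longleftrightarrow> {u, w} \<in> E" if "u \<noteq> v" "w \<noteq> v" for u w
    using that unfolding F_def by (auto simp: doubleton_eq_iff)
  have "clique (insert v V) F Q \<longleftrightarrow> (v \<in> Q \<and> Q \<subseteq> insert v C) \<or> clique V E Q"
  proof (cases "v \<in> Q")
    case True
    have "\<not> clique V E Q" using True v by (auto simp: clique_def)
    moreover have "Q \<subseteq> insert v C" if "clique (insert v V) F Q"
    proof
      fix x assume "x \<in> Q"
      then have "x = v \<or> {x, v} \<in> F"
        using that True unfolding clique_def by blast
      then show "x \<in> insert v C" using nb by blast
    qed
    moreover have "clique (insert v V) F Q" if Qs: "Q \<subseteq> insert v C"
      unfolding clique_def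
    proof (intro conjI ballI impI)
      show "Q \<subseteq> insert v V" using Qs C by (auto simp: clique_def)
      fix a b assume ab: "a \<in> Q" "b \<in> Q" "a \<noteq> b"
      consider "a = v" "b \<noteq> v" "b \<in> C" | "b = v" "a \<noteq> v" "a \<in> C" | "a \<noteq> v" "b \<noteq> v" "a \<in> C" "b \<in> C"
        using Qs ab by blast
      then show "{a, b} \<in> F"
      proof cases
        case 1
        then show ?thesis using nb[of b] by (simp add: insert_commute)
      next
        case 2
        then show ?thesis using nb[of a] by simp
      next
        case 3
        then show ?thesis using C ab old[of a b] unfolding clique_def by simp
      qed
    qed
    ultimately show ?thesis using True by blast
  next
    case False
    then have "{a, b} \<in> F \<longleftrightarrow> {a, b} \<in> E" if "a \<in> Q" "b \<in> Q" for a b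
      using old[of a b] that by blast
    then have "clique (insert v V) F Q \<longleftrightarrow> clique V E Q"
      unfolding clique_def using False by (simp add: subset_insert)
    then show ?thesis using False by simp
  qed
  then show ?thesis by (simp add: F_def)
qed

section \<open>Degrees and the deletion of vertices of degree k\<close>

definition neighbours :: "'a set set \<Rightarrow> 'a \<Rightarrow> 'a set" where
  "neighbours E v = {u. {u, v} \<in> E}"

lemma mem_neighbours [simp]: "u \<in> neighbours E v \<longleftrightarrow> {u, v} \<in> E"
  by (simp add: neighbours_def)

lemma neighbours_subset:
  assumes "E \<subseteq> all_edges V"
  shows "neighbours E v \<subseteq> V - {v}"
  using assms by (auto simp: all_edges_def doubleton_eq_iff)

lemma neighbours_complete: "x \<in> V \<Longrightarrow> neighbours (all_edges V) x = V - {x}"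
  by (rule set_eqI) simp

lemma neighbours_extend:
  assumes E: "E \<subseteq> all_edges V" and C: "C \<subseteq> V" and v: "v \<notin> V"
  shows "neighbours (E \<union> {{u, v} | u. u \<in> C}) x =
    (if x = v then C else if x \<in> C then insert v (neighbours E x) else neighbours E x)"
  using assms by (auto simp: all_edges_def doubleton_eq_iff)

lemma k_tree_degree_ge:
  assumes "k_tree k V E" "x \<in> V"
  shows "k \<le> card (neighbours E x)"
  using assms
proof (induction arbitrary: x rule: k_tree.induct)
  case (complete V)
  then show ?case by (simp add: neighbours_complete)
next
  case (extend V E C v)
  note b = k_tree_basic[OF extend.hyps(1)]
  have fin: "finite (neighbours E x)"
    using neighbours_subset[OF b(2)] b(1) by (meson finite_Diff finite_subset)
  have CV: "C \<subseteq> V" using extend.hyps by (simp add: clique_def)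
  show ?case
    unfolding neighbours_extend[OF b(2) CV extend.hyps(4)]
    using extend fin by (auto simp: card_insert_if intro: le_SucI)
qed

text \<open>With \<open>k_tree_degree_ge\<close> this makes \<open>k\<close> the minimum degree, so
  the program can recover \<open>k\<close> from the input.\<close>

lemma k_tree_degree_eq_exists:
  assumes "k_tree k V E"
  shows "\<exists>x\<in>V. card (neighbours E x) = k"
  using assms
proof cases
  case complete
  then obtain x where x: "x \<in> V" by fastforce
  show ?thesis using complete x by (intro bexI[of _ x]) (simp_all add: neighbours_complete)
next
  case (extend V' E' C v)
  have "C \<subseteq> V'" using extend by (simp add: clique_def)
  then have "neighbours E v = C"
    unfolding extend(2) using neighbours_extend[OF k_tree_basic(2)[OF extend(3)], of C v v] extend by simp
  then show ?thesis using extend by auto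
qed

lemma delete_vertex_edges:
  assumes "E \<subseteq> all_edges V"
  shows "E = {e \<in> E. v \<notin> e} \<union> {{u, v} | u. u \<in> neighbours E v}"
proof -
  have "\<exists>u. e = {u, v}" if "e \<in> E" "v \<in> e" for e
    using that assms by (auto simp: all_edges_def)
  then show ?thesis by auto
qed

text \<open>The vertex \<open>x\<close> need not be the last one added. If the last one is
  \<open>v\<close> and differs from \<open>x\<close>, then \<open>x\<close> is not in its attachment
  clique, for otherwise \<open>x\<close> had degree \<open>k - 1\<close> before. So the deletion of
  \<open>x\<close> commutes with the attachment of \<open>v\<close>, provided that \<open>x\<close>
  can already be deleted before \<open>v\<close> is attached.\<close>

lemma k_tree_delete_vertex:
  assumes "k_tree k V E" "k + 1 < card V" "x \<in> V" "card (neighbours E x) = k"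
  shows "k_tree k (V - {x}) {e \<in> E. x \<notin> e} \<and> clique V E (neighbours E x)"
  using assms
proof (induction arbitrary: x rule: k_tree.induct)
  case (complete V)
  then show ?case by simp
next
  case (extend V E C v)
  let ?E = "E \<union> {{u, v} | u. u \<in> C}"
  note b = k_tree_basic[OF extend.hyps(1)]
  have C: "C \<subseteq> V" "finite C" using extend.hyps b by (auto simp: clique_def dest: finite_subset)
  have nE: "v \<notin> e" if "e \<in> E" for e
    using that b(2) extend.hyps(4) by (auto simp: all_edges_def)
  note nbr = neighbours_extend[OF b(2) C(1) extend.hyps(4)]
  have clq: "clique (insert v V) ?E Q" if "clique V E Q" for Q
    using that clique_extend_iff[OF b(2) extend.hyps(2,4)] by blast
  show ?case
  proof (cases "x = v")
    case True
    have "{e \<in> ?E. v \<notin> e} = E" using nE by auto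
    moreover have "insert v V - {v} = V" using extend.hyps(4) by simp
    moreover have "neighbours ?E v = C" using nbr[of v] by simp
    ultimately show ?thesis using True extend.hyps(1,2) clq by simp
  next
    case False
    have xV: "x \<in> V" using False extend.prems by simp
    have fin: "finite (neighbours E x)" "v \<notin> neighbours E x"
      using neighbours_subset[OF b(2), of x] b(1) extend.hyps(4) by (auto dest: finite_subset)
    have xC: "x \<notin> C"
    proof
      assume "x \<in> C"
      then have "card (neighbours ?E x) = Suc (card (neighbours E x))"
        using nbr[of x] False fin by simp
      then show False using extend.prems(3) k_tree_degree_ge[OF extend.hyps(1) xV] by simp
    qed
    have nx: "neighbours ?E x = neighbours E x" using nbr[of x] False xC by simp
    have Ex: "{e \<in> ?E. x \<notin> e} = {e \<in> E. x \<notin> e} \<union> {{u, v} | u. u \<in> C}"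
      using False xC by auto
    have Vx: "insert v V - {x} = insert v (V - {x})" using False by auto
    show ?thesis
    proof (cases "card V = k + 1")
      case True
      \<comment> \<open>Before \<open>v\<close> there are only \<open>k + 1\<close> vertices, too
        few for the induction hypothesis. Then \<open>C\<close> consists of all of them except
        \<open>x\<close>, and \<open>v\<close> simply replaces \<open>x\<close> in the complete
        graph.\<close>
      have Eall: "E = all_edges V" using k_tree_minimal_complete[OF extend.hyps(1) True] .
      have "card (V - {x}) = k" using True xV b(1) by simp
      then have CV: "C = V - {x}"
        using C(1) xC extend.hyps(3) b(1) by (intro card_subset_eq) auto
      have "{e \<in> E. x \<notin> e} \<union> {{u, v} | u. u \<in> C} = all_edges (insert v C)"
        unfolding Eall CV using extend.hyps(4) by (auto simp: all_edges_def insert_commute)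
      moreover have "k_tree k (insert v C) (all_edges (insert v C))"
        using C extend.hyps(3,4) by (intro k_tree.complete) (auto simp: card_insert_if)
      moreover have "neighbours E x = C"
        using xV unfolding Eall CV by (rule neighbours_complete)
      ultimately show ?thesis unfolding nx Ex Vx using CV clq extend.hyps(2) by simp
    next
      case False
      then have IH: "k_tree k (V - {x}) {e \<in> E. x \<notin> e}" "clique V E (neighbours E x)"
        using extend.IH[of x] b(3) xV nx extend.prems(3) by auto
      have "clique (V - {x}) {e \<in> E. x \<notin> e} C"
        using extend.hyps(2) xC by (auto simp: clique_def)
      then have "k_tree k (insert v (V - {x})) ({e \<in> E. x \<notin> e} \<union> {{u, v} | u. u \<in> C})"
        using IH(1) extend.hyps(3,4) by (intro k_tree.extend) auto
      then show ?thesis unfolding nx Ex Vx using IH(2) clq by simp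
    qed
  qed
qed

text \<open>The list records the attachment cliques, the last one first.\<close>

inductive k_tree_seq :: "nat \<Rightarrow> 'a set \<Rightarrow> 'a set set \<Rightarrow> 'a set list \<Rightarrow> bool" for k :: nat where
  complete: "finite V \<Longrightarrow> card V = k + 1 \<Longrightarrow> k_tree_seq k V (all_edges V) []"
| extend: "k_tree_seq k V E cs \<Longrightarrow> clique V E C \<Longrightarrow> card C = k \<Longrightarrow> v \<notin> V \<Longrightarrow>
    k_tree_seq k (insert v V) (E \<union> {{u, v} | u. u \<in> C}) (C # cs)"

text \<open>A removal read backwards is an attachment, so an elimination order yields a construction
  order.\<close>

lemma k_tree_seq_delete_vertex:
  assumes "k_tree k V E" "k + 1 < card V" "x \<in> V" "card (neighbours E x) = k"
    and seq: "k_tree_seq k (V - {x}) {e \<in> E. x \<notin> e} cs"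
  shows "k_tree_seq k V E (neighbours E x # cs)"
proof -
  note b = k_tree_basic[OF assms(1)]
  have "clique V E (neighbours E x)" using k_tree_delete_vertex[OF assms(1-4)] by simp
  then have "clique (V - {x}) {e \<in> E. x \<notin> e} (neighbours E x)"
    using neighbours_subset[OF b(2), of x] unfolding clique_def by blast
  from k_tree_seq.extend[OF seq this assms(4), of x]
  have "k_tree_seq k (insert x (V - {x})) ({e \<in> E. x \<notin> e} \<union> {{u, x} | u. u \<in> neighbours E x})
    (neighbours E x # cs)" by simp
  then show ?thesis
    unfolding delete_vertex_edges[OF b(2), of x, symmetric] insert_Diff[OF assms(3)] .
qed

lemma k_tree_seq_imp_k_tree: "k_tree_seq k V E cs \<Longrightarrow> k_tree k V E"
  by (induction rule: k_tree_seq.induct) (auto intro: k_tree.intros)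

section \<open>Maximal cliques and multiplicities of attachment cliques\<close>

lemma clique_complete: "clique V (all_edges V) Q \<longleftrightarrow> Q \<subseteq> V"
  by (auto simp: clique_def all_edges_def)

lemma k_tree_clique_extends:
  assumes "k_tree k V E" "clique V E Q"
  shows "\<exists>Q'. Q \<subseteq> Q' \<and> clique V E Q' \<and> card Q' = k + 1"
  using assms
proof (induction arbitrary: Q rule: k_tree.induct)
  case (complete V)
  then show ?case by (intro exI[of _ V]) (simp add: clique_complete)
next
  case (extend V E C v)
  note b = k_tree_basic[OF extend.hyps(1)]
  note iff = clique_extend_iff[OF b(2) extend.hyps(2,4)]
  have "finite C" "v \<notin> C" using extend.hyps b by (auto simp: clique_def dest: finite_subset)
  then have "card (insert v C) = k + 1" using extend.hyps(3) by simp
  moreover have "clique (insert v V) (E \<union> {{u, v} | u. u \<in> C}) (insert v C)"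
    using iff[of "insert v C"] by simp
  moreover have "\<exists>Q'. Q \<subseteq> Q' \<and> clique (insert v V) (E \<union> {{u, v} | u. u \<in> C}) Q' \<and> card Q' = k + 1"
    if Q: "clique V E Q"
  proof -
    obtain Q' where "Q \<subseteq> Q'" "clique V E Q'" "card Q' = k + 1" using extend.IH[OF Q] by blast
    then show ?thesis using iff[of Q'] by blast
  qed
  ultimately show ?case
    using extend.prems unfolding iff[of Q] by blast
qed

lemma k_tree_max_cliques:
  assumes "k_tree k V E"
  shows "max_cliques V E = {Q. clique V E Q \<and> card Q = k + 1}"
proof -
  have fin: "finite Q" if "clique V E Q" for Q
    using that k_tree_basic(1)[OF assms] by (auto simp: clique_def dest: finite_subset)
  have "Q' = Q" if Q: "clique V E Q" "card Q = k + 1" and Q': "clique V E Q'" "Q \<subseteq> Q'" for Q Q'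
  proof -
    obtain Q2 where Q2: "Q' \<subseteq> Q2" "clique V E Q2" "card Q2 = k + 1"
      using k_tree_clique_extends[OF assms Q'(1)] by blast
    have "Q = Q2"
      using Q2 Q' Q fin by (intro card_subset_eq) auto
    then show ?thesis using Q2 Q' by blast
  qed
  moreover have "card Q = k + 1" if "Q \<in> max_cliques V E" for Q
  proof -
    have "clique V E Q" using that by (simp add: max_cliques_def)
    then obtain Q' where "Q \<subseteq> Q'" "clique V E Q'" "card Q' = k + 1"
      using k_tree_clique_extends[OF assms] by blast
    moreover from this have "Q' = Q" using that by (simp add: max_cliques_def)
    ultimately show ?thesis by simp
  qed
  ultimately show ?thesis by (auto simp: max_cliques_def)
qed

lemma finite_max_cliques: "finite V \<Longrightarrow> finite (max_cliques V E)"
  by (rule finite_subset[of _ "Pow V"]) (auto simp: max_cliques_def clique_def)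

lemma k_tree_max_cliques_extend:
  assumes kt: "k_tree k V E" and C: "clique V E C" "card C = k" and v: "v \<notin> V"
  shows "max_cliques (insert v V) (E \<union> {{u, v} | u. u \<in> C}) = insert (insert v C) (max_cliques V E)"
proof -
  note b = k_tree_basic[OF kt]
  note iff = clique_extend_iff[OF b(2) C(1) v]
  have CC: "finite C" "v \<notin> C" using C b v by (auto simp: clique_def dest: finite_subset)
  then have "card (insert v C) = k + 1" using C(2) by simp
  moreover have "Q = insert v C" if "Q \<subseteq> insert v C" "card Q = k + 1" for Q
    using that CC calculation by (intro card_subset_eq) auto
  ultimately show ?thesis
    unfolding k_tree_max_cliques[OF kt] k_tree_max_cliques[OF k_tree.extend[OF kt C v]] iff
    by blast
qed

lemma k_tree_seq_attachments:
  assumes "k_tree_seq k V E cs" "C \<in> set cs"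
  shows "clique V E C \<and> card C = k"
  using assms
proof (induction rule: k_tree_seq.induct)
  case (extend V E cs D v)
  have "clique V E C \<and> card C = k" using extend by auto
  then show ?case by (simp add: clique_def subset_insertI2)
qed simp

lemma max_cliques_complete: "max_cliques V (all_edges V) = {V}"
  by (auto simp: max_cliques_def clique_complete)

text \<open>Every attachment to \<open>D\<close> creates one new maximal clique above
  \<open>D\<close>, in addition to the one that any \<open>k\<close>-clique has when it first
  occurs. The left side mentions only the graph, so multiplicities are independent of the
  construction order. It is stated for all \<open>k\<close>-cliques so that it can also detect which
  of them are recorded.\<close>

lemma k_tree_seq_count:
  assumes "k_tree_seq k V E cs" "clique V E D" "card D = k"
  shows "card {Q \<in> max_cliques V E. D \<subseteq> Q} = count_list cs D + 1"
  using assms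
proof (induction arbitrary: D rule: k_tree_seq.induct)
  case (complete V)
  then have "{Q \<in> max_cliques V (all_edges V). D \<subseteq> Q} = {V}"
    by (auto simp: clique_complete max_cliques_complete)
  then show ?case by simp
next
  case (extend V E cs C v)
  have kt: "k_tree k V E" by (rule k_tree_seq_imp_k_tree) fact
  note b = k_tree_basic[OF kt]
  note iff = clique_extend_iff[OF b(2) extend.hyps(2,4)]
  note mc = k_tree_max_cliques_extend[OF kt extend.hyps(2,3,4)]
  have CV: "C \<subseteq> V" "finite C" using extend.hyps b by (auto simp: clique_def dest: finite_subset)
  have mcV: "Q \<subseteq> V" if "Q \<in> max_cliques V E" for Q using that by (auto simp: max_cliques_def clique_def)
  show ?case
  proof (cases "v \<in> D")
    case True
    then have "\<not> clique V E D" using extend.hyps(4) by (auto simp: clique_def)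
    then have "D \<subseteq> insert v C" using iff[of D] extend.prems by blast
    moreover have "\<not> D \<subseteq> Q" if "Q \<in> max_cliques V E" for Q
      using that mcV True extend.hyps(4) by blast
    ultimately have "{Q \<in> insert (insert v C) (max_cliques V E). D \<subseteq> Q} = {insert v C}" by auto
    \<comment> \<open>Recorded cliques consist of older vertices, so a clique containing
      \<open>v\<close> has count 0.\<close>
    moreover have "D \<notin> set (C # cs)"
      using True extend.hyps(4) CV(1) k_tree_seq_attachments[OF extend.hyps(1), of D]
      by (auto simp: clique_def)
    then have "count_list (C # cs) D = 0" by (rule count_notin)
    ultimately show ?thesis unfolding mc by simp
  next
    case False
    then have D: "clique V E D" using iff[of D] extend.prems by blast
    have "D \<subseteq> insert v C \<longleftrightarrow> D = C"
      using False CV extend.prems(2) extend.hyps(3) card_subset_eq[of C D] by auto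
    then have eq: "{Q \<in> insert (insert v C) (max_cliques V E). D \<subseteq> Q} =
      (if D = C then insert (insert v C) {Q \<in> max_cliques V E. D \<subseteq> Q} else {Q \<in> max_cliques V E. D \<subseteq> Q})"
      by auto
    have "insert v C \<notin> max_cliques V E" using mcV extend.hyps(4) by blast
    then show ?thesis
      unfolding mc eq using extend.IH[OF D extend.prems(2)] finite_max_cliques[OF b(1)] by auto
  qed
qed

section \<open>Counting the clique trees of a k-tree\<close>

text \<open>A new maximal clique \<open>insert v C\<close> enlarges the block of \<open>C\<close> if
  \<open>C\<close> has been used before and opens a new block otherwise. Other blocks do not change:
  the only \<open>k\<close>-subset of \<open>insert v C\<close> that avoids \<open>v\<close> is
  \<open>C\<close>.\<close>

lemma k_tree_seq_block_tree:
  assumes "k_tree_seq k V E cs"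
  shows "block_tree (max_cliques V E) (set cs) (\<lambda>C. {Q \<in> max_cliques V E. C \<subseteq> Q})"
  using assms
proof (induction rule: k_tree_seq.induct)
  case (complete V)
  then show ?case by (simp add: max_cliques_complete block_tree.single)
next
  case (extend V E cs C v)
  have kt: "k_tree k V E" by (rule k_tree_seq_imp_k_tree) fact
  note b = k_tree_basic[OF kt]
  note mc = k_tree_max_cliques_extend[OF kt extend.hyps(2,3,4)]
  let ?M = "max_cliques V E"
  let ?B = "\<lambda>C. {Q \<in> ?M. C \<subseteq> Q}" and ?B' = "\<lambda>D. {Q \<in> insert (insert v C) ?M. D \<subseteq> Q}"
  have CV: "C \<subseteq> V" "finite C" using extend.hyps b by (auto simp: clique_def dest: finite_subset)
  have new: "insert v C \<notin> ?M" using extend.hyps(4) by (auto simp: max_cliques_def clique_def)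
  have other: "?B' D = ?B D" if "D \<in> set cs" "D \<noteq> C" for D
  proof -
    have D: "D \<subseteq> V" "card D = k"
      using k_tree_seq_attachments[OF extend.hyps(1) that(1)] by (auto simp: clique_def)
    have "\<not> D \<subseteq> insert v C"
      using D that(2) extend.hyps(3,4) CV card_subset_eq[of C D] by auto
    then show ?thesis by auto
  qed
  have same: "?B' C = insert (insert v C) (?B C)" by auto
  show ?case
  proof (cases "C \<in> set cs")
    case True
    have "block_tree (insert (insert v C) ?M) (set cs) ?B'"
      by (rule block_tree_enlarge_block[OF extend.IH True new]) (use other same in auto)
    then show ?thesis unfolding mc using True by (simp add: insert_absorb)
  next
    case False
    have "count_list cs C = 0" using False by (simp add: count_list_0_iff)
    then have "card (?B C) = 1"
      using k_tree_seq_count[OF extend.hyps(1,2,3)] by simp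
    then obtain x where x: "?B C = {x}" by (auto simp: card_1_singleton_iff)
    have "block_tree (?M \<union> {insert v C}) (insert C (set cs)) ?B'"
    proof (rule block_tree.attach[OF extend.IH, of x])
      show "x \<in> ?M" using x by auto
      show "{insert v C} \<inter> ?M = {}" using new by simp
      show "\<forall>D\<in>set cs. ?B' D = ?B D" using other False by auto
      show "?B' C = insert x {insert v C}" unfolding same x by auto
    qed (use False in auto)
    then show ?thesis unfolding mc by simp
  qed
qed

text \<open>All spanning trees have \<open>card V - 1\<close> edges, so no weight exceeds
  \<open>k * (card V - 1)\<close>. By \<open>ne\<close> this bound is attained, and only trees whose
  edges all have weight \<open>k\<close> attain it.\<close>

lemma max_weight_spanning_trees_eq:
  fixes w :: "'a set \<Rightarrow> nat"
  assumes fin: "finite V" and E: "E \<subseteq> all_edges V" and le: "\<And>e. e \<in> E \<Longrightarrow> w e \<le> k"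
    and ne: "trees V {e \<in> E. w e = k} \<noteq> {}"
  shows "{T. max_weight_spanning_tree V E w T} = trees V {e \<in> E. w e = k}"
proof -
  obtain T0 where T0: "T0 \<in> trees V {e \<in> E. w e = k}" using ne by blast
  have fT: "finite T" if "T \<in> trees V E" for T
    using that finite_subset[OF _ finite_subset[OF E finite_all_edges[OF fin]]] by (simp add: trees_def)
  have sub: "trees V {e \<in> E. w e = k} \<subseteq> trees V E" by (auto simp: trees_def)
  have upper: "sum w T \<le> k * (card V - 1)" if "T \<in> trees V E" for T
    using sum_bounded_above[of T w k] that le by (auto simp: trees_def mult.commute)
  have exact: "sum w T = k * (card V - 1)" if "T \<in> trees V {e \<in> E. w e = k}" for T
  proof -
    have "sum w T = (\<Sum>e\<in>T. k)" using that by (intro sum.cong) (auto simp: trees_def)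
    then show ?thesis using that by (auto simp: trees_def)
  qed
  have max: "T \<in> trees V {e \<in> E. w e = k}"
    if T: "T \<in> trees V E" and mx: "\<forall>T'. T' \<in> trees V E \<longrightarrow> sum w T' \<le> sum w T" for T
  proof -
    have "sum w T0 \<le> sum w T" using T0 sub mx by blast
    then have ge: "(\<Sum>e\<in>T. k) \<le> sum w T" using exact[OF T0] T by (simp add: trees_def mult.commute)
    have "w e = k" if e: "e \<in> T" for e
    proof (rule ccontr)
      assume "w e \<noteq> k"
      then have "w e < k" using le[of e] T e by (auto simp: trees_def)
      moreover have "\<forall>e\<in>T. w e \<le> k" using T le by (auto simp: trees_def)
      ultimately have "sum w T < (\<Sum>e\<in>T. k)"
        using e by (intro sum_strict_mono_ex1[OF fT[OF T]]) blast+
      then show False using ge by simp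
    qed
    then show ?thesis using T by (auto simp: trees_def)
  qed
  show ?thesis
    unfolding max_weight_spanning_tree_def spanning_tree_iff_trees[OF fin E]
  proof (intro equalityI subsetI CollectI)
    fix T assume "T \<in> {T. T \<in> trees V E \<and> (\<forall>T'. T' \<in> trees V E \<longrightarrow> sum w T' \<le> sum w T)}"
    then show "T \<in> trees V {e \<in> E. w e = k}" using max by simp
  next
    fix T assume T: "T \<in> trees V {e \<in> E. w e = k}"
    then show "T \<in> trees V E \<and> (\<forall>T'. T' \<in> trees V E \<longrightarrow> sum w T' \<le> sum w T)"
      unfolding exact[OF T] using upper sub by blast
  qed
qed

theorem card_clique_trees_k_tree_seq:
  assumes seq: "k_tree_seq k V E cs" and k: "k \<ge> 1"
  shows "card (clique_trees V E) = (\<Prod>C\<in>set cs. (count_list cs C + 1) ^ (count_list cs C - 1))"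
proof -
  have kt: "k_tree k V E" by (rule k_tree_seq_imp_k_tree) fact
  note b = k_tree_basic[OF kt]
  let ?M = "max_cliques V E" and ?X = "clique_intersection_edges V E"
  let ?B = "\<lambda>C. {Q \<in> ?M. C \<subseteq> Q}"
  have finM: "finite ?M" by (rule finite_max_cliques[OF b(1)])
  have M: "clique V E Q" "card Q = k + 1" "finite Q" if "Q \<in> ?M" for Q
    using that b(1) unfolding k_tree_max_cliques[OF kt] by (auto simp: clique_def dest: finite_subset)
  have X: "?X \<subseteq> all_edges ?M" by (auto simp: clique_intersection_edges_def all_edges_def)
  have int: "card (Q \<inter> Q') \<le> k" if "Q \<in> ?M" "Q' \<in> ?M" "Q \<noteq> Q'" for Q Q'
  proof (rule ccontr)
    assume "\<not> card (Q \<inter> Q') \<le> k"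
    then have "k + 1 \<le> card (Q \<inter> Q')" by simp
    then have "Q \<inter> Q' = Q" "Q \<inter> Q' = Q'"
      using M(2,3)[OF that(1)] M(2,3)[OF that(2)]
        card_seteq[of Q "Q \<inter> Q'"] card_seteq[of Q' "Q \<inter> Q'"] by auto
    then show False using that(3) by simp
  qed
  have le: "clique_weight e \<le> k" if eX: "e \<in> ?X" for e
  proof -
    obtain Q Q' where "e = {Q, Q'}" "Q \<in> ?M" "Q' \<in> ?M" "Q \<noteq> Q'"
      using eX unfolding clique_intersection_edges_def by blast
    then show ?thesis using int[of Q Q'] by (simp add: clique_weight_def)
  qed
  \<comment> \<open>An intersection with \<open>k\<close> vertices is a \<open>k\<close>-clique
    below two maximal cliques, hence has a positive count and is recorded. Conversely, two members
    of the block of \<open>C\<close> share \<open>C\<close>, and \<open>int\<close> allows nothing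
    more.\<close>
  have H: "{e \<in> ?X. clique_weight e = k} = (\<Union>C\<in>set cs. all_edges (?B C))"
  proof (intro equalityI subsetI)
    fix e assume eX: "e \<in> {e \<in> ?X. clique_weight e = k}"
    then obtain Q Q' where "e = {Q, Q'}" "Q \<in> ?M" "Q' \<in> ?M" "Q \<noteq> Q'"
      unfolding clique_intersection_edges_def by blast
    moreover from this have "card (Q \<inter> Q') = k" using eX by (simp add: clique_weight_def)
    ultimately have e: "e = {Q, Q'}" "Q \<in> ?M" "Q' \<in> ?M" "Q \<noteq> Q'" "card (Q \<inter> Q') = k"
      by blast+
    have cl: "clique V E (Q \<inter> Q')" using M(1)[OF e(2)] by (auto simp: clique_def)
    have "card {Q, Q'} \<le> card (?B (Q \<inter> Q'))"
      using finM e by (intro card_mono) auto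
    then have "count_list cs (Q \<inter> Q') \<noteq> 0"
      using k_tree_seq_count[OF seq cl e(5)] e(4) by simp
    then have "Q \<inter> Q' \<in> set cs" by (meson count_notin)
    moreover have "e \<in> all_edges (?B (Q \<inter> Q'))" using e by simp
    ultimately show "e \<in> (\<Union>C\<in>set cs. all_edges (?B C))" by blast
  next
    fix e assume "e \<in> (\<Union>C\<in>set cs. all_edges (?B C))"
    then obtain C Q Q' where e: "C \<in> set cs" "e = {Q, Q'}" "Q \<noteq> Q'" "Q \<in> ?M" "Q' \<in> ?M"
      "C \<subseteq> Q \<inter> Q'"
      unfolding all_edges_def by blast
    have "card C = k" using k_tree_seq_attachments[OF seq e(1)] by simp
    then have "k \<le> card (Q \<inter> Q')" using e M(3) card_mono[of "Q \<inter> Q'" C] by auto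
    then have c: "card (Q \<inter> Q') = k" using int[OF e(4,5,3)] by simp
    \<comment> \<open>An edge of the clique-intersection graph needs a nonempty intersection; this
      is where \<open>k\<close> is used to be positive.\<close>
    then have "Q \<inter> Q' \<noteq> {}" using k by auto
    then show "e \<in> {e \<in> ?X. clique_weight e = k}"
      using e(2-5) c unfolding clique_intersection_edges_def clique_weight_def by fastforce
  qed
  have "card (trees ?M {e \<in> ?X. clique_weight e = k})
      = (\<Prod>C\<in>set cs. card (?B C) ^ (card (?B C) - 2))"
    unfolding H by (rule card_trees_block_tree[OF k_tree_seq_block_tree[OF seq]])
  also have "\<dots> = (\<Prod>C\<in>set cs. (count_list cs C + 1) ^ (count_list cs C - 1))"
    using k_tree_seq_count[OF seq] k_tree_seq_attachments[OF seq] by (intro prod.cong) auto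
  finally have count: "card (trees ?M {e \<in> ?X. clique_weight e = k})
      = (\<Prod>C\<in>set cs. (count_list cs C + 1) ^ (count_list cs C - 1))" .
  \<comment> \<open>A product of powers of positive numbers is not 0, so the graph of the heaviest
    edges has a spanning tree.\<close>
  then have ne: "trees ?M {e \<in> ?X. clique_weight e = k} \<noteq> {}"
    by (intro notI) simp
  have "clique_trees V E = trees ?M {e \<in> ?X. clique_weight e = k}"
    unfolding clique_trees_def by (rule max_weight_spanning_trees_eq[OF finM X le ne])
  then show ?thesis using count by simp
qed

section \<open>Running time of programs\<close>

definition runs :: "com \<Rightarrow> state \<Rightarrow> nat \<Rightarrow> (state \<Rightarrow> bool) \<Rightarrow> bool" where
  "runs c s b Q \<longleftrightarrow> (\<exists>t s'. exec c s t s' \<and> t \<le> b \<and> Q s')"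

lemma runs_mono:
  assumes "runs c s b Q" "b \<le> b'" "\<And>s'. Q s' \<Longrightarrow> Q' s'"
  shows "runs c s b' Q'"
  using assms unfolding runs_def by (meson order_trans)

lemma runs_Seq:
  assumes p: "runs p s b P" and q: "\<And>s'. P s' \<Longrightarrow> runs q s' b' Q"
  shows "runs (Seq p q) s (b + b') Q"
proof -
  obtain t s' where 1: "exec p s t s'" "t \<le> b" "P s'" using p by (auto simp: runs_def)
  obtain t' s'' where 2: "exec q s' t' s''" "t' \<le> b'" "Q s''" using q[OF 1(3)] by (auto simp: runs_def)
  show ?thesis unfolding runs_def using exec.Seq[OF 1(1) 2(1)] 1(2) 2(2,3) by (meson add_mono)
qed

text \<open>The potential \<open>\<Phi>\<close> bounds the remaining running time, so its decrease also gives termination.\<close>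

lemma runs_While:
  fixes \<Phi> :: "state \<Rightarrow> nat"
  assumes step: "\<And>s. I s \<Longrightarrow> bval b s \<Longrightarrow>
      \<exists>t. runs c s t (\<lambda>s'. I s' \<and> bcost b + 1 + t + \<Phi> s' \<le> \<Phi> s)"
    and I: "I s"
  shows "runs (While b c) s (\<Phi> s + bcost b + 1) (\<lambda>s'. I s' \<and> \<not> bval b s')"
  using I
proof (induction "\<Phi> s" arbitrary: s rule: less_induct)
  case less
  show ?case
  proof (cases "bval b s")
    case False
    then show ?thesis using less.prems exec.WhileFalse[OF False] by (fastforce simp: runs_def)
  next
    case True
    obtain t u s' where u: "exec c s u s'" "u \<le> t" "I s'" "bcost b + 1 + t + \<Phi> s' \<le> \<Phi> s"
      using step[OF less.prems True] by (auto simp: runs_def)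
    then have "\<Phi> s' < \<Phi> s" by linarith
    from less.hyps[OF this u(3)] obtain t' s'' where
      t': "exec (While b c) s' t' s''" "t' \<le> \<Phi> s' + bcost b + 1" "I s''" "\<not> bval b s''"
      by (auto simp: runs_def)
    have "bcost b + 1 + u + t' \<le> \<Phi> s + bcost b + 1" using u(2,4) t'(2) by linarith
    then show ?thesis
      unfolding runs_def using exec.WhileTrue[OF True u(1) t'(1)] t'(3,4) by blast
  qed
qed

primrec loop_free :: "com \<Rightarrow> bool" where
  "loop_free Skip = True"
| "loop_free (Assign x a b) = True"
| "loop_free (Seq p q) = (loop_free p \<and> loop_free q)"
| "loop_free (Cond b p q) = (loop_free p \<and> loop_free q)"
| "loop_free (While b p) = False"

text \<open>Symbolic execution: for code without loops, preservation of an invariant becomes a goal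
  about explicit state updates. The \<open>While\<close> clauses here and in \<open>ccost\<close>
  are dummies, excluded by \<open>loop_free\<close>.\<close>

primrec eff :: "com \<Rightarrow> state \<Rightarrow> state" where
  "eff Skip s = s"
| "eff (Assign x a b) s = s(x := (s x)(aval a s := aval b s))"
| "eff (Seq p q) s = eff q (eff p s)"
| "eff (Cond b p q) s = (if bval b s then eff p s else eff q s)"
| "eff (While b p) s = s"

primrec ccost :: "com \<Rightarrow> nat" where
  "ccost Skip = 1"
| "ccost (Assign x a b) = acost a + acost b + 1"
| "ccost (Seq p q) = ccost p + ccost q"
| "ccost (Cond b p q) = bcost b + 1 + max (ccost p) (ccost q)"
| "ccost (While b p) = 0"

lemma exec_loop_free: "loop_free c \<Longrightarrow> \<exists>t. exec c s t (eff c s) \<and> t \<le> ccost c"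
proof (induction c arbitrary: s)
  case Skip
  then show ?case using exec.Skip by fastforce
next
  case (Assign x a b)
  show ?case using exec.Assign[of x a b s] by (intro exI[of _ "ccost (Assign x a b)"]) (simp del: fun_upd_apply)
next
  case (Seq p q)
  obtain t where t: "exec p s t (eff p s)" "t \<le> ccost p" using Seq by auto
  obtain t' where t': "exec q (eff p s) t' (eff q (eff p s))" "t' \<le> ccost q" using Seq by auto
  show ?case using exec.Seq[OF t(1) t'(1)] t(2) t'(2) by (auto intro!: exI[of _ "t + t'"])
next
  case (Cond b p q)
  show ?case
  proof (cases "bval b s")
    case True
    obtain t where "exec p s t (eff p s)" "t \<le> ccost p" using Cond by auto
    then show ?thesis using exec.CondTrue[of b s p t "eff p s" q] True by fastforce
  next
    case False
    obtain t where "exec q s t (eff q s)" "t \<le> ccost q" using Cond by auto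
    then show ?thesis using exec.CondFalse[of b s q t "eff q s" p] False by fastforce
  qed
qed simp

lemma runs_loop_free: "loop_free c \<Longrightarrow> Q (eff c s) \<Longrightarrow> runs c s (ccost c) Q"
  using exec_loop_free[of c s] by (auto simp: runs_def)

lemma runs_Seq_loop_free:
  assumes "loop_free p" "runs q (eff p s) b Q"
  shows "runs (Seq p q) s (ccost p + b) Q"
  using runs_Seq[OF runs_loop_free[of p "\<lambda>s'. s' = eff p s"]] assms by simp

text \<open>The potential is \<open>d * \<mu> s\<close>: one round with its test and control step
  costs at most \<open>d\<close>, and the additional \<open>d\<close> pays for the final failing
  test. All applications use the round value 100.\<close>

lemma runs_While_loop_free:
  fixes \<mu> :: "state \<Rightarrow> nat"
  assumes lf: "loop_free c"
    and step: "\<And>s. I s \<Longrightarrow> bval b s \<Longrightarrow> I (eff c s) \<and> \<mu> (eff c s) < \<mu> s"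
    and I: "I s"
    and exit: "\<And>s. I s \<Longrightarrow> \<not> bval b s \<Longrightarrow> Q s"
    and cost: "ccost c + bcost b + 1 \<le> d"
  shows "runs (While b c) s (d * \<mu> s + d) Q"
proof -
  have "runs (While b c) s (d * \<mu> s + bcost b + 1) (\<lambda>s'. I s' \<and> \<not> bval b s')"
  proof (rule runs_While[where \<Phi> = "\<lambda>s. d * \<mu> s" and I = I])
    show "I s" by (rule I)
  next
    fix s assume s: "I s" "bval b s"
    have "d * Suc (\<mu> (eff c s)) \<le> d * \<mu> s"
      using step[OF s] by (intro mult_le_mono2) simp
    then have "bcost b + 1 + ccost c + d * \<mu> (eff c s) \<le> d * \<mu> s"
      using cost by simp
    then have "runs c s (ccost c) (\<lambda>s'. I s' \<and> bcost b + 1 + ccost c + d * \<mu> s' \<le> d * \<mu> s)"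
      using step[OF s] by (intro runs_loop_free lf) simp
    then show "\<exists>t. runs c s t (\<lambda>s'. I s' \<and> bcost b + 1 + t + d * \<mu> s' \<le> d * \<mu> s)" by blast
  qed
  then show ?thesis by (rule runs_mono) (use cost exit in auto)
qed

section \<open>The program\<close>

text \<open>
  \<open>LOW\<close> receives the minimum degree, which is \<open>k\<close>. \<open>WT\<close> holds \<open>2 ^ v\<close> as long as the vertex \<open>v\<close> is
  present and 0 after its removal; so summing \<open>WT\<close> over the neighbours of a vertex gives the binary
  code of its attachment clique.
\<close>

abbreviation (input) "NUM \<equiv> (0 :: nat)"
abbreviation (input) "OFF \<equiv> (1 :: nat)"
abbreviation (input) "ADJ \<equiv> (2 :: nat)"
abbreviation (input) "RES \<equiv> (3 :: nat)"
abbreviation (input) "DEG \<equiv> (4 :: nat)"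
abbreviation (input) "WT \<equiv> (5 :: nat)"
abbreviation (input) "QUEUE \<equiv> (6 :: nat)"
abbreviation (input) "KEY \<equiv> (7 :: nat)"
abbreviation (input) "CNT \<equiv> (8 :: nat)"
abbreviation (input) "SEEN \<equiv> (9 :: nat)"
abbreviation (input) "VTX \<equiv> (10 :: nat)"
abbreviation (input) "LOW \<equiv> (11 :: nat)"
abbreviation (input) "TAIL \<equiv> (12 :: nat)"
abbreviation (input) "HEAD \<equiv> (13 :: nat)"
abbreviation (input) "POS \<equiv> (14 :: nat)"
abbreviation (input) "ACC \<equiv> (15 :: nat)"
abbreviation (input) "NBR \<equiv> (16 :: nat)"
abbreviation (input) "POW \<equiv> (17 :: nat)"

abbreviation (input) get :: "nat \<Rightarrow> aexp" where "get x \<equiv> Cell x (Const 0)"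
abbreviation (input) put :: "nat \<Rightarrow> aexp \<Rightarrow> com" where "put x a \<equiv> Assign x (Const 0) a"
abbreviation (input) incr :: "nat \<Rightarrow> com" where "incr x \<equiv> put x (Plus (get x) (Const 1))"

fun seqs :: "com list \<Rightarrow> com" where
  "seqs [] = Skip"
| "seqs (c # cs) = Seq c (seqs cs)"

definition degrees_body :: com where
  "degrees_body = seqs [
     Assign WT (get VTX) (get POW),
     put POW (Plus (get POW) (get POW)),
     Assign DEG (get VTX) (Minus (Cell OFF (Plus (get VTX) (Const 1))) (Cell OFF (get VTX))),
     Cond (Less (Cell DEG (get VTX)) (get LOW)) (put LOW (Cell DEG (get VTX))) Skip,
     incr VTX]"

text \<open>The first list starts at position 0, so cell 1 of \<open>OFF\<close> is the degree of
  vertex 0. Thus \<open>LOW\<close> starts with a degree that occurs.\<close>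

definition degrees_start :: com where
  "degrees_start = seqs [put LOW (Cell OFF (Const 1)), put POW (Const 1)]"

definition degrees_loop :: com where
  "degrees_loop = While (Less (get VTX) (get NUM)) degrees_body"

definition degrees_prog :: com where
  "degrees_prog = Seq degrees_start (Seq degrees_loop (put VTX (Const 0)))"

definition enqueue :: "nat \<Rightarrow> com" where
  "enqueue x = Cond (Equal (Cell DEG (get x)) (get LOW))
     (seqs [Assign QUEUE (get TAIL) (get x), incr TAIL]) Skip"

definition queue_prog :: com where
  "queue_prog = While (Less (get VTX) (get NUM)) (seqs [enqueue VTX, incr VTX])"

definition neighbour_body :: com where
  "neighbour_body = seqs [
     put NBR (Cell ADJ (get POS)),
     Cond (Less (Const 0) (Cell WT (get NBR))) (seqs [
       put ACC (Plus (get ACC) (Cell WT (get NBR))),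
       Assign DEG (get NBR) (Minus (Cell DEG (get NBR)) (Const 1)),
       enqueue NBR]) Skip,
     incr POS]"

definition remove_start :: com where
  "remove_start = seqs [
     put VTX (Cell QUEUE (get HEAD)),
     Assign WT (get VTX) (Const 0),
     put POS (Cell OFF (get VTX)),
     put ACC (Const 0)]"

definition remove_loop :: com where
  "remove_loop = While (Less (get POS) (Cell OFF (Plus (get VTX) (Const 1)))) neighbour_body"

text \<open>The codes range up to \<open>2 ^ n\<close>, so the table \<open>CNT\<close> cannot be
  scanned in linear time; \<open>KEY\<close> logs which of its cells are in use.\<close>

definition remove_finish :: com where
  "remove_finish = seqs [
     Assign KEY (get HEAD) (get ACC),
     Assign CNT (get ACC) (Plus (Cell CNT (get ACC)) (Const 1)),
     incr HEAD]"

text \<open>\<open>HEAD\<close> is also the number of removed vertices, so the loop ends when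
  \<open>LOW + 1\<close> vertices are left, the initial complete graph of a construction.\<close>

definition eliminate_prog :: com where
  "eliminate_prog = While (Less (Plus (get HEAD) (Plus (get LOW) (Const 1))) (get NUM))
     (Seq remove_start (Seq remove_loop remove_finish))"

definition product_body :: com where
  "product_body = seqs [
     put ACC (Cell KEY (get POS)),
     Cond (Equal (Cell SEEN (get ACC)) (Const 0))
       (Assign SEEN (get ACC) (Const 1))
       (put RES (Times (get RES) (Plus (Cell CNT (get ACC)) (Const 1)))),
     incr POS]"

definition product_prog :: com where
  "product_prog = seqs [
     put RES (Const 1),
     put POS (Const 0),
     While (Less (get POS) (get HEAD)) product_body]"

definition clique_tree_prog :: com where
  "clique_tree_prog = Seq degrees_prog (Seq queue_prog (Seq eliminate_prog product_prog))"

section \<open>Correctness and running time\<close>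

lemma map_upt_fun_upd_snoc:
  "h \<le> t \<Longrightarrow> map (f(t := u)) [h..<Suc t] = map f [h..<t] @ [u]"
  by simp

text \<open>The partial result after \<open>j\<close> keys: the bases already use the final
  multiplicities, while the exponents count repetitions only within the prefix. For
  \<open>j = length ks\<close> it is the product of Cayley's formula over the distinct keys.\<close>

definition repeat_product :: "nat list \<Rightarrow> nat \<Rightarrow> nat" where
  "repeat_product ks j =
    (\<Prod>x\<in>set (take j ks). (count_list ks x + 1) ^ (count_list (take j ks) x - 1))"

lemma repeat_product_Suc:
  assumes j: "j < length ks"
  shows "repeat_product ks (Suc j) =
    (if ks ! j \<in> set (take j ks) then repeat_product ks j * (count_list ks (ks ! j) + 1)
     else repeat_product ks j)"
proof -
  let ?x = "ks ! j" and ?t = "take j ks"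
  have t: "take (Suc j) ks = ?t @ [?x]" using j by (simp add: take_Suc_conv_app_nth)
  let ?f = "\<lambda>t x. (count_list ks x + 1) ^ (count_list t x - 1)"
  have other: "(\<Prod>x\<in>set ?t - {?x}. ?f (?t @ [?x]) x) = (\<Prod>x\<in>set ?t - {?x}. ?f ?t x)"
    by (intro prod.cong) auto
  show ?thesis
  proof (cases "?x \<in> set ?t")
    case True
    then have "count_list ?t ?x \<noteq> 0" by (simp add: count_list_0_iff)
    then obtain c where c: "count_list ?t ?x = Suc c" using not0_implies_Suc by blast
    have "repeat_product ks (Suc j) = ?f (?t @ [?x]) ?x * (\<Prod>x\<in>set ?t - {?x}. ?f (?t @ [?x]) x)"
      unfolding repeat_product_def t using True
      by (subst prod.remove[of _ ?x]) (auto simp: insert_absorb)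
    also have "\<dots> = (?f ?t ?x * (\<Prod>x\<in>set ?t - {?x}. ?f ?t x)) * (count_list ks ?x + 1)"
      unfolding other by (simp add: c algebra_simps)
    also have "?f ?t ?x * (\<Prod>x\<in>set ?t - {?x}. ?f ?t x) = repeat_product ks j"
      unfolding repeat_product_def using True by (subst prod.remove[of _ ?x, symmetric]) auto
    finally show ?thesis using True by simp
  next
    case False
    have "repeat_product ks (Suc j) = (\<Prod>x\<in>insert ?x (set ?t). ?f (?t @ [?x]) x)"
      unfolding repeat_product_def t by simp
    also have "\<dots> = ?f (?t @ [?x]) ?x * (\<Prod>x\<in>set ?t. ?f (?t @ [?x]) x)"
      using False by (intro prod.insert) auto
    also have "\<dots> = repeat_product ks j"
      using other False unfolding repeat_product_def by simp
    finally show ?thesis using False by simp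
  qed
qed

text \<open>The direction of the handshake lemma that the cost bound needs: an edge comes from at
  most two ordered pairs.\<close>

lemma sum_degrees_le:
  fixes E :: "nat set set"
  assumes E: "E \<subseteq> all_edges {0..<n}"
  shows "(\<Sum>v<n. card (neighbours E v)) \<le> 2 * card E"
proof -
  have fin: "finite E" using finite_subset[OF E finite_all_edges] by simp
  have nb: "finite (neighbours E v)" for v
    using neighbours_subset[OF E, of v] finite_subset by blast
  have "(\<Sum>v<n. card (neighbours E v)) = card (SIGMA v:{..<n}. neighbours E v)"
    using nb by (subst card_SigmaI) auto
  also have "\<dots> \<le> card (\<Union>e\<in>E. {(v, u). {u, v} = e})"
  proof (rule card_mono)
    have "{(v, u). {u, v} = e} \<subseteq> e \<times> e" for e :: "nat set" by auto
    moreover have "finite e" if "e \<in> E" for e using that E by (auto simp: all_edges_def)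
    ultimately show "finite (\<Union>e\<in>E. {(v, u). {u, v} = e})"
      using fin by (meson finite_SigmaI finite_UN_I finite_subset)
  qed auto
  also have "\<dots> \<le> (\<Sum>e\<in>E. card {(v, u). {u, v} = e})" by (rule card_UN_le[OF fin])
  also have "\<dots> \<le> (\<Sum>e\<in>E. 2)"
  proof (rule sum_mono)
    fix e assume "e \<in> E"
    then obtain a b where "e = {a, b}" using E by (auto simp: all_edges_def)
    then have "{(v, u). {u, v} = e} \<subseteq> set [(a, b), (b, a)]" by (auto simp: doubleton_eq_iff)
    then have "card {(v, u). {u, v} = e} \<le> card (set [(a, b), (b, a)])" by (rule card_mono[rotated]) simp
    also have "\<dots> \<le> 2" by (rule order_trans[OF card_length]) simp
    finally show "card {(v, u). {u, v} = e} \<le> 2" .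
  qed
  finally show ?thesis by simp
qed

section \<open>The adjacency lists in memory\<close>

locale k_tree_input =
  fixes k n :: nat and E :: "nat set set" and adj :: "nat list list"
  assumes k_pos: "k \<ge> 1" and k_tree: "k_tree k {0..<n} E" and adj: "adjacency_lists n E adj"
begin

definition "offset i = length (concat (take i adj))"

lemma length_adj: "length adj = n" and distinct_adj: "v < n \<Longrightarrow> distinct (adj ! v)"
  and set_adj: "v < n \<Longrightarrow> set (adj ! v) = neighbours E v"
  using adj by (auto simp: adjacency_lists_def)

lemma length_adj_nth: "v < n \<Longrightarrow> length (adj ! v) = card (neighbours E v)"
  using distinct_adj set_adj distinct_card by metis

lemma offset_Suc: "v < n \<Longrightarrow> offset (Suc v) = offset v + length (adj ! v)"
  using length_adj by (simp add: offset_def take_Suc_conv_app_nth)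

lemma concat_nth:
  assumes "v < n" "i < length (adj ! v)"
  shows "offset v + i < length (concat adj)" "concat adj ! (offset v + i) = adj ! v ! i"
proof -
  have "adj = take v adj @ adj ! v # drop (Suc v) adj"
    using assms(1) length_adj by (simp add: id_take_nth_drop)
  then have eq: "concat adj = concat (take v adj) @ adj ! v @ concat (drop (Suc v) adj)"
    by (metis concat.simps(2) concat_append)
  show "offset v + i < length (concat adj)" unfolding eq offset_def using assms(2) by simp
  show "concat adj ! (offset v + i) = adj ! v ! i"
    unfolding eq offset_def nth_append using assms(2) by simp
qed

abbreviation "s\<^sub>0 \<equiv> input_state adj"

lemma input_num: "s\<^sub>0 NUM 0 = n"
  by (simp add: input_state_def length_adj)

lemma input_off: "i \<le> n \<Longrightarrow> s\<^sub>0 OFF i = offset i"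
  by (simp add: input_state_def length_adj offset_def)

lemma input_adj: "v < n \<Longrightarrow> i < length (adj ! v) \<Longrightarrow> s\<^sub>0 ADJ (offset v + i) = adj ! v ! i"
  using concat_nth[of v i] by (simp add: input_state_def)

lemma input_zero: "x \<ge> 3 \<Longrightarrow> s\<^sub>0 x = (\<lambda>_. 0)"
  by (auto simp: input_state_def)

lemma n_pos: "n > 0"
  using k_tree_basic(3)[OF k_tree] by simp

section \<open>Computing degrees and filling the queue\<close>

definition degrees_inv :: "state \<Rightarrow> bool" where
  "degrees_inv s \<longleftrightarrow> (\<forall>x\<in>{NUM, OFF, ADJ, CNT, SEEN, TAIL, HEAD}. s x = s\<^sub>0 x) \<and>
     s VTX 0 \<le> n \<and> s POW 0 = 2 ^ s VTX 0 \<and>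
     (\<forall>v < s VTX 0. s WT v = 2 ^ v \<and> s DEG v = length (adj ! v) \<and> s LOW 0 \<le> length (adj ! v)) \<and>
     (\<exists>v<n. s LOW 0 = length (adj ! v))"

lemma degrees_inv_step:
  assumes "degrees_inv s" "s VTX 0 < n"
  shows "degrees_inv (eff degrees_body s) \<and> eff degrees_body s VTX 0 = Suc (s VTX 0)"
proof -
  have "s OFF (Suc (s VTX 0)) - s OFF (s VTX 0) = length (adj ! (s VTX 0))"
    using assms input_off[of "Suc (s VTX 0)"] input_off[of "s VTX 0"] offset_Suc[of "s VTX 0"]
    by (simp add: degrees_inv_def)
  then show ?thesis
    using assms by (auto simp: degrees_body_def degrees_inv_def less_Suc_eq)
qed

definition ready_inv :: "state \<Rightarrow> bool" where
  "ready_inv s \<longleftrightarrow> (\<forall>x\<in>{NUM, OFF, ADJ, CNT, SEEN, HEAD}. s x = s\<^sub>0 x) \<and> s LOW 0 = k \<and>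
     (\<forall>v < n. s WT v = 2 ^ v \<and> s DEG v = card (neighbours E v)) \<and>
     s VTX 0 \<le> n \<and> distinct (map (s QUEUE) [0..<s TAIL 0]) \<and>
     set (map (s QUEUE) [0..<s TAIL 0]) = {v. v < s VTX 0 \<and> card (neighbours E v) = k}"

text \<open>\<open>LOW\<close> is the degree of some vertex, hence at least \<open>k\<close>; it is
  below all degrees, and one of them is \<open>k\<close>.\<close>

lemma degrees_inv_ready:
  assumes "degrees_inv s" "s VTX 0 = n"
  shows "ready_inv (s(VTX := (s VTX)(0 := 0)))"
proof -
  have "s LOW 0 = k"
  proof (rule antisym)
    obtain v where "v < n" "card (neighbours E v) = k"
      using k_tree_degree_eq_exists[OF k_tree] by auto
    then show "s LOW 0 \<le> k" using assms length_adj_nth[of v] by (auto simp: degrees_inv_def)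
    obtain v where "v < n" "s LOW 0 = length (adj ! v)" using assms by (auto simp: degrees_inv_def)
    then show "k \<le> s LOW 0" using k_tree_degree_ge[OF k_tree, of v] length_adj_nth[of v] by simp
  qed
  then show ?thesis
    using assms by (simp add: degrees_inv_def ready_inv_def input_zero length_adj_nth)
qed

lemma degrees_prog_runs:
  "runs degrees_prog s\<^sub>0 (100 * n + 200) (\<lambda>s. ready_inv s \<and> s VTX 0 = 0)"
proof -
  have "s\<^sub>0 OFF 1 = length (adj ! 0)"
    using input_off[of 1] offset_Suc[of 0] n_pos by (simp add: offset_def)
  then have start: "degrees_inv (eff degrees_start s\<^sub>0)" "eff degrees_start s\<^sub>0 VTX 0 = 0"
    using n_pos by (auto simp: degrees_start_def degrees_inv_def input_zero)
  have "runs degrees_loop (eff degrees_start s\<^sub>0) (100 * (n - eff degrees_start s\<^sub>0 VTX 0) + 100)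
      (\<lambda>s. degrees_inv s \<and> s VTX 0 = n)"
    unfolding degrees_loop_def
  proof (rule runs_While_loop_free[where I = degrees_inv])
    show "loop_free degrees_body" "ccost degrees_body + bcost (Less (get VTX) (get NUM)) + 1 \<le> 100"
      by (simp_all add: degrees_body_def)
  next
    fix s assume s: "degrees_inv s"
    then have n: "s NUM 0 = n" by (simp add: degrees_inv_def input_num)
    show "degrees_inv (eff degrees_body s) \<and> n - eff degrees_body s VTX 0 < n - s VTX 0"
      if "bval (Less (get VTX) (get NUM)) s"
      using degrees_inv_step[OF s] that n by auto
    show "degrees_inv s \<and> s VTX 0 = n" if "\<not> bval (Less (get VTX) (get NUM)) s"
      using s n that by (auto simp: degrees_inv_def)
  qed (fact start(1))
  then have "runs (Seq degrees_loop (put VTX (Const 0))) (eff degrees_start s\<^sub>0)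
      ((100 * (n - eff degrees_start s\<^sub>0 VTX 0) + 100) + ccost (put VTX (Const 0)))
      (\<lambda>s. ready_inv s \<and> s VTX 0 = 0)"
  proof (rule runs_Seq)
    fix s assume "degrees_inv s \<and> s VTX 0 = n"
    then show "runs (put VTX (Const 0)) s (ccost (put VTX (Const 0))) (\<lambda>s. ready_inv s \<and> s VTX 0 = 0)"
      using degrees_inv_ready[of s] by (intro runs_loop_free) (simp_all del: fun_upd_apply add: fun_upd_same)
  qed
  then have "runs degrees_prog s\<^sub>0 (ccost degrees_start
      + ((100 * (n - eff degrees_start s\<^sub>0 VTX 0) + 100) + ccost (put VTX (Const 0))))
      (\<lambda>s. ready_inv s \<and> s VTX 0 = 0)"
    unfolding degrees_prog_def by (intro runs_Seq_loop_free) (simp_all add: degrees_start_def)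
  then show ?thesis by (rule runs_mono) (use start(2) in \<open>simp_all add: degrees_start_def\<close>)
qed

lemma ready_inv_step:
  assumes "ready_inv s" "s VTX 0 < n"
  shows "ready_inv (eff (seqs [enqueue VTX, incr VTX]) s) \<and>
    eff (seqs [enqueue VTX, incr VTX]) s VTX 0 = Suc (s VTX 0)"
proof (cases "card (neighbours E (s VTX 0)) = k")
  case True
  have "{v. v < Suc (s VTX 0) \<and> card (neighbours E v) = k}
      = insert (s VTX 0) {v. v < s VTX 0 \<and> card (neighbours E v) = k}"
    using True by (auto simp: less_Suc_eq)
  then show ?thesis
    using assms True map_upt_fun_upd_snoc[of 0 "s TAIL 0" "s QUEUE" "s VTX 0"]
    by (auto simp: ready_inv_def enqueue_def simp del: upt_Suc)
next
  case False
  have "{v. v < Suc (s VTX 0) \<and> card (neighbours E v) = k}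
      = {v. v < s VTX 0 \<and> card (neighbours E v) = k}"
    using False by (auto simp: less_Suc_eq)
  then show ?thesis using assms False by (auto simp: ready_inv_def enqueue_def)
qed

lemma queue_prog_runs:
  assumes "ready_inv s" "s VTX 0 = 0"
  shows "runs queue_prog s (100 * n + 100) (\<lambda>s. ready_inv s \<and> s VTX 0 = n)"
proof -
  have "runs queue_prog s (100 * (n - s VTX 0) + 100) (\<lambda>s. ready_inv s \<and> s VTX 0 = n)"
    unfolding queue_prog_def
  proof (rule runs_While_loop_free[where I = ready_inv])
    show "loop_free (seqs [enqueue VTX, incr VTX])"
      "ccost (seqs [enqueue VTX, incr VTX]) + bcost (Less (get VTX) (get NUM)) + 1 \<le> 100"
      by (simp_all add: enqueue_def)
  next
    fix s assume s: "ready_inv s"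
    then have n: "s NUM 0 = n" by (simp add: ready_inv_def input_num)
    show "ready_inv (eff (seqs [enqueue VTX, incr VTX]) s) \<and>
        n - eff (seqs [enqueue VTX, incr VTX]) s VTX 0 < n - s VTX 0"
      if "bval (Less (get VTX) (get NUM)) s"
      using ready_inv_step[OF s] that n by auto
    show "ready_inv s \<and> s VTX 0 = n" if "\<not> bval (Less (get VTX) (get NUM)) s"
      using s n that by (auto simp: ready_inv_def)
  qed (fact assms(1))
  then show ?thesis using assms(2) by simp
qed

section \<open>Elimination of vertices of degree k\<close>

definition induced :: "nat set \<Rightarrow> nat set set" where
  "induced R = {e \<in> E. e \<subseteq> R}"

lemma E_subset: "E \<subseteq> all_edges {0..<n}"
  by (rule k_tree_basic(2)[OF k_tree])

lemma induced_all: "induced {0..<n} = E"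
  using E_subset by (auto simp: induced_def all_edges_def)

lemma neighbours_induced: "v \<in> R \<Longrightarrow> neighbours (induced R) v = neighbours E v \<inter> R"
  by (auto simp: induced_def)

lemma induced_delete: "induced (R - {v}) = {e \<in> induced R. v \<notin> e}"
  by (auto simp: induced_def)

definition nbr_done :: "nat \<Rightarrow> state \<Rightarrow> nat set" where
  "nbr_done v s = set (take (s POS 0 - offset v) (adj ! v))"

text \<open>\<open>s1\<close> is the state before the scan of the list of \<open>v\<close>, and in
  use \<open>R\<close> no longer contains \<open>v\<close>. The queue is read from
  \<open>Suc (s1 HEAD 0)\<close> because its head is still \<open>v\<close>: \<open>HEAD\<close>
  advances only after the scan.\<close>

definition nbr_inv :: "state \<Rightarrow> nat set \<Rightarrow> nat \<Rightarrow> state \<Rightarrow> bool" where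
  "nbr_inv s1 R v s \<longleftrightarrow>
     (\<forall>x\<in>{NUM, OFF, ADJ, WT, KEY, CNT, SEEN, VTX, LOW, HEAD}. s x = s1 x) \<and>
     offset v \<le> s POS 0 \<and> s POS 0 \<le> offset v + length (adj ! v) \<and>
     s ACC 0 = set_encode (nbr_done v s \<inter> R) \<and>
     (\<forall>u\<in>R. s DEG u = s1 DEG u - (if u \<in> nbr_done v s then 1 else 0)) \<and>
     Suc (s1 HEAD 0) \<le> s TAIL 0 \<and>
     distinct (map (s QUEUE) [Suc (s1 HEAD 0)..<s TAIL 0]) \<and>
     set (map (s QUEUE) [Suc (s1 HEAD 0)..<s TAIL 0]) = {u \<in> R. s DEG u = k}"

text \<open>The last assumption on \<open>s1\<close> is decisive: a present neighbour of
  \<open>v\<close> has degree above \<open>k\<close>, so it is not yet queued, and it enters the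
  queue exactly if its decremented degree is \<open>k\<close>.\<close>

lemma nbr_inv_step:
  assumes s1: "s1 ADJ = s\<^sub>0 ADJ" "s1 LOW 0 = k" "\<forall>u<n. s1 WT u = (if u \<in> R then 2 ^ u else 0)"
    "\<forall>u\<in>R. u \<in> neighbours E v \<longrightarrow> k < s1 DEG u"
    and v: "v < n" and inv: "nbr_inv s1 R v s" and lt: "s POS 0 < offset v + length (adj ! v)"
  shows "nbr_inv s1 R v (eff neighbour_body s) \<and> eff neighbour_body s POS 0 = Suc (s POS 0)"
proof -
  define i where "i = s POS 0 - offset v"
  define u where "u = adj ! v ! i"
  define s' where "s' = eff neighbour_body s"
  have pos: "s POS 0 = offset v + i" "i < length (adj ! v)"
    using inv lt by (auto simp: nbr_inv_def i_def)
  have fr: "s ADJ = s1 ADJ" "s WT = s1 WT" "s LOW = s1 LOW" using inv by (auto simp: nbr_inv_def)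
  have nbr: "s ADJ (s POS 0) = u" using input_adj[OF v pos(2)] s1(1) fr pos(1) by (simp add: u_def)
  have uE: "u \<in> neighbours E v" using set_adj[OF v] pos(2) nth_mem unfolding u_def by blast
  then have un: "u < n" using neighbours_subset[OF E_subset, of v] by auto
  \<comment> \<open>Adjacency lists are distinct, so \<open>u\<close> is met for the first time: its
    degree drops only once and \<open>2 ^ u\<close> is a new bit of the code.\<close>
  have udone: "u \<notin> nbr_done v s"
    using distinct_adj[OF v] pos(2) by (auto simp: nbr_done_def i_def[symmetric] u_def in_set_conv_nth nth_eq_iff_index_eq)
  have done': "nbr_done v s' = insert u (nbr_done v s)" if "s' POS 0 = Suc (s POS 0)"
  proof -
    have "s' POS 0 - offset v = Suc i" using that pos by simp
    then show ?thesis
      using pos(2) by (simp add: nbr_done_def i_def[symmetric] u_def take_Suc_conv_app_nth)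
  qed
  have fin: "finite (nbr_done v s \<inter> R)" by (simp add: nbr_done_def)
  show ?thesis
  proof (cases "u \<in> R")
    case False
    have wt: "s WT u = 0" using False s1(3) un fr by simp
    have eq: "s' = s(NBR := (s NBR)(0 := u), POS := (s POS)(0 := Suc (s POS 0)))"
      using wt nbr by (simp add: s'_def neighbour_body_def)
    have P: "s' POS 0 = Suc (s POS 0)" using eq by simp
    have "nbr_inv s1 R v s'"
      unfolding nbr_inv_def done'[OF P]
      using inv pos False unfolding nbr_inv_def by (auto simp: eq)
    then show ?thesis using P by (simp add: s'_def)
  next
    case True
    have wt: "s WT u = 2 ^ u" using True s1(3) un fr by simp
    have degu: "s DEG u = s1 DEG u" "k < s1 DEG u"
      using inv True udone s1(4) uE by (auto simp: nbr_inv_def)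
    let ?t = "s(NBR := (s NBR)(0 := u), ACC := (s ACC)(0 := s ACC 0 + 2 ^ u),
      DEG := (s DEG)(u := s DEG u - 1))"
    have acc: "set_encode (insert u (nbr_done v s) \<inter> R) = s ACC 0 + 2 ^ u"
      using inv True udone fin by (simp add: nbr_inv_def Int_insert_left)
    show ?thesis
    proof (cases "s DEG u - 1 = k")
      case False
      have eq: "s' = ?t(POS := (s POS)(0 := Suc (s POS 0)))"
        using wt nbr False s1(2) fr by (simp add: s'_def neighbour_body_def enqueue_def)
      have P: "s' POS 0 = Suc (s POS 0)" using eq by simp
      have "{w \<in> R. s' DEG w = k} = {w \<in> R. s DEG w = k}"
        using False degu by (auto simp: eq)
      then have "nbr_inv s1 R v s'"
        unfolding nbr_inv_def done'[OF P] acc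
        using inv pos udone degu unfolding nbr_inv_def by (auto simp: eq)
      then show ?thesis using P by (simp add: s'_def)
    next
      case push: True
      have eq: "s' = ?t(QUEUE := (s QUEUE)(s TAIL 0 := u), TAIL := (s TAIL)(0 := Suc (s TAIL 0)),
          POS := (s POS)(0 := Suc (s POS 0)))"
        using wt nbr push s1(2) fr by (simp add: s'_def neighbour_body_def enqueue_def)
      have P: "s' POS 0 = Suc (s POS 0)" using eq by simp
      have "{w \<in> R. s' DEG w = k} = insert u {w \<in> R. s DEG w = k}"
        using push degu True by (auto simp: eq)
      moreover have "map (s' QUEUE) [Suc (s1 HEAD 0)..<s' TAIL 0]
          = map (s QUEUE) [Suc (s1 HEAD 0)..<s TAIL 0] @ [u]"
        using inv map_upt_fun_upd_snoc[of "Suc (s1 HEAD 0)" "s TAIL 0" "s QUEUE" u]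
        by (simp add: eq nbr_inv_def del: upt_Suc)
      moreover have "u \<notin> {w \<in> R. s DEG w = k}" using degu by simp
      moreover have "s' ACC 0 = s ACC 0 + 2 ^ u" "Suc (s1 HEAD 0) \<le> s' TAIL 0"
        "\<forall>x\<in>{NUM, OFF, ADJ, WT, KEY, CNT, SEEN, VTX, LOW, HEAD}. s' x = s1 x"
        "\<forall>w\<in>R. s' DEG w = s1 DEG w - (if w \<in> insert u (nbr_done v s) then 1 else 0)"
        using inv degu unfolding nbr_inv_def by (auto simp: eq)
      ultimately have "nbr_inv s1 R v s'"
        unfolding nbr_inv_def done'[OF P] acc
        using inv pos P unfolding nbr_inv_def by simp
      then show ?thesis using P by (simp add: s'_def)
    qed
  qed
qed

text \<open>Elimination finds the last attachment first, whereas \<open>k_tree_seq\<close> is built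
  starting from the complete graph. The quantifier over \<open>cs'\<close> bridges this: any
  construction of the remaining graph is completed by the cliques found so far.\<close>

definition elim_inv :: "nat set \<Rightarrow> nat set list \<Rightarrow> state \<Rightarrow> bool" where
  "elim_inv R cs s \<longleftrightarrow> (\<forall>x\<in>{NUM, OFF, ADJ, SEEN}. s x = s\<^sub>0 x) \<and> s LOW 0 = k \<and>
     R \<subseteq> {0..<n} \<and> k_tree k R (induced R) \<and> card R + s HEAD 0 = n \<and>
     (\<forall>v<n. s WT v = (if v \<in> R then 2 ^ v else 0)) \<and>
     (\<forall>v\<in>R. s DEG v = card (neighbours (induced R) v)) \<and>
     s HEAD 0 \<le> s TAIL 0 \<and> distinct (map (s QUEUE) [s HEAD 0..<s TAIL 0]) \<and>
     set (map (s QUEUE) [s HEAD 0..<s TAIL 0]) = {v \<in> R. s DEG v = k} \<and>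
     (\<forall>cs'. k_tree_seq k R (induced R) cs' \<longrightarrow> k_tree_seq k {0..<n} E (cs @ cs')) \<and>
     length cs = s HEAD 0 \<and> (\<forall>i<s HEAD 0. s KEY i = set_encode (cs ! i)) \<and>
     s CNT = count_list (map set_encode cs)"

lemma elim_inv_start:
  assumes "ready_inv s" "s VTX 0 = n"
  shows "elim_inv {0..<n} [] s"
proof -
  have "set (map (s QUEUE) [0..<s TAIL 0]) = {v \<in> {0..<n}. s DEG v = k}"
    using assms unfolding ready_inv_def by auto
  then show ?thesis
    using assms k_tree unfolding elim_inv_def ready_inv_def induced_all
    by (auto simp: input_zero)
qed

text \<open>The queue is nonempty because the remaining \<open>k\<close>-tree has a vertex of degree
  \<open>k\<close>. The scan passes over removed neighbours too, so its cost is governed by the full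
  list of \<open>v\<close>.\<close>

lemma remove_vertex_runs:
  assumes inv: "elim_inv R cs s" and lt: "s HEAD 0 + (k + 1) < n"
  defines "v \<equiv> s QUEUE (s HEAD 0)"
  shows "v \<in> R"
    "runs (Seq remove_start (Seq remove_loop remove_finish)) s (100 * length (adj ! v) + 200)
      (elim_inv (R - {v}) (cs @ [neighbours (induced R) v]))"
proof -
  have fr: "s NUM = s\<^sub>0 NUM" "s OFF = s\<^sub>0 OFF" "s ADJ = s\<^sub>0 ADJ" "s SEEN = s\<^sub>0 SEEN" "s LOW 0 = k"
    and Rn: "R \<subseteq> {0..<n}" and kt: "k_tree k R (induced R)" and cR: "card R + s HEAD 0 = n"
    and wt: "\<forall>v<n. s WT v = (if v \<in> R then 2 ^ v else 0)"
    and deg: "\<forall>v\<in>R. s DEG v = card (neighbours (induced R) v)"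
    and dq: "distinct (map (s QUEUE) [s HEAD 0..<s TAIL 0])"
    and sq: "set (map (s QUEUE) [s HEAD 0..<s TAIL 0]) = {v \<in> R. s DEG v = k}"
    and seq: "\<forall>cs'. k_tree_seq k R (induced R) cs' \<longrightarrow> k_tree_seq k {0..<n} E (cs @ cs')"
    and cs: "length cs = s HEAD 0" "\<forall>i<s HEAD 0. s KEY i = set_encode (cs ! i)"
      "s CNT = count_list (map set_encode cs)"
    using inv by (simp_all add: elim_inv_def)
  obtain x where "x \<in> R" "card (neighbours (induced R) x) = k"
    using k_tree_degree_eq_exists[OF kt] by blast
  then have "x \<in> set (map (s QUEUE) [s HEAD 0..<s TAIL 0])" using sq deg by auto
  then have ht: "s HEAD 0 < s TAIL 0" by auto
  then have upt: "map (s QUEUE) [s HEAD 0..<s TAIL 0] = v # map (s QUEUE) [Suc (s HEAD 0)..<s TAIL 0]"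
    by (simp add: upt_conv_Cons v_def)
  have "v \<in> {v \<in> R. s DEG v = k}" using sq unfolding upt by auto
  then have vR: "v \<in> R" and vk: "card (neighbours (induced R) v) = k" using deg by auto
  show "v \<in> R" by (rule vR)
  have vn: "v < n" using vR Rn by auto
  have finR: "finite R" using Rn finite_subset by blast
  have big: "k + 1 < card R" using lt cR by simp
  let ?R = "R - {v}" and ?C = "neighbours (induced R) v"
  have kt': "k_tree k ?R (induced ?R)"
    using k_tree_delete_vertex[OF kt big vR vk] by (simp add: induced_delete)
  have nb': "neighbours (induced ?R) u = neighbours (induced R) u - {v}" if "u \<in> ?R" for u
    using that by (auto simp: neighbours_induced)
  have finN: "finite (neighbours (induced R) u)" if "u \<in> R" for u
    using that finR by (simp add: neighbours_induced)
  have sym: "v \<in> neighbours (induced R) u \<longleftrightarrow> u \<in> neighbours E v" if "u \<in> R" for u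
    using that vR by (auto simp: neighbours_induced insert_commute)
  have deg': "card (neighbours (induced ?R) u) = s DEG u - (if u \<in> neighbours E v then 1 else 0)"
    if "u \<in> ?R" for u
    using that nb'[OF that] deg sym[of u] finN[of u] by auto
  \<comment> \<open>The graph without \<open>v\<close> is still a \<open>k\<close>-tree, so the
    degree of \<open>u\<close> is at least \<open>k\<close> even after losing \<open>v\<close>.
    Positivity of \<open>k\<close> excludes that the truncated subtraction acted on 0.\<close>
  have large: "k < s DEG u" if "u \<in> ?R" "u \<in> neighbours E v" for u
  proof -
    have "k \<le> s DEG u - 1" using k_tree_degree_ge[OF kt' that(1)] deg'[OF that(1)] that(2) by simp
    then show ?thesis using k_pos by linarith
  qed
  define s1 where "s1 = eff remove_start s"
  have s1: "s1 = s(VTX := (s VTX)(0 := v), WT := (s WT)(v := 0), POS := (s POS)(0 := offset v),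
      ACC := (s ACC)(0 := 0))"
    using fr(2) input_off[of v] vn by (simp add: s1_def remove_start_def v_def)
  have init: "nbr_inv s1 ?R v s1"
  proof -
    have "set (map (s1 QUEUE) [Suc (s1 HEAD 0)..<s1 TAIL 0]) = {u \<in> ?R. s1 DEG u = k}"
      using sq dq unfolding upt by (auto simp: s1)
    moreover have "distinct (map (s1 QUEUE) [Suc (s1 HEAD 0)..<s1 TAIL 0])"
      using dq unfolding upt by (simp add: s1)
    ultimately show ?thesis using ht by (simp add: nbr_inv_def nbr_done_def s1)
  qed
  have loop: "runs remove_loop s1 (100 * (offset v + length (adj ! v) - s1 POS 0) + 100)
      (\<lambda>s'. nbr_inv s1 ?R v s' \<and> s' POS 0 = offset v + length (adj ! v))"
    unfolding remove_loop_def
  proof (rule runs_While_loop_free[where I = "nbr_inv s1 ?R v"])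
    show "loop_free neighbour_body"
      "ccost neighbour_body + bcost (Less (get POS) (Cell OFF (Plus (get VTX) (Const 1)))) + 1 \<le> 100"
      by (simp_all add: neighbour_body_def enqueue_def)
  next
    fix t assume t: "nbr_inv s1 ?R v t"
    then have e: "t OFF (t VTX 0 + 1) = offset v + length (adj ! v)"
      using fr(2) input_off[of "Suc v"] offset_Suc[OF vn] vn by (simp add: nbr_inv_def s1)
    show "nbr_inv s1 ?R v (eff neighbour_body t) \<and>
        offset v + length (adj ! v) - eff neighbour_body t POS 0 < offset v + length (adj ! v) - t POS 0"
      if "bval (Less (get POS) (Cell OFF (Plus (get VTX) (Const 1)))) t"
    proof -
      have "t POS 0 < offset v + length (adj ! v)" using that e by simp
      moreover from this have "nbr_inv s1 ?R v (eff neighbour_body t) \<and>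
          eff neighbour_body t POS 0 = Suc (t POS 0)"
        using fr wt large by (intro nbr_inv_step vn t) (auto simp: s1)
      ultimately show ?thesis by simp
    qed
    show "nbr_inv s1 ?R v t \<and> t POS 0 = offset v + length (adj ! v)"
      if "\<not> bval (Less (get POS) (Cell OFF (Plus (get VTX) (Const 1)))) t"
      using t e that by (simp add: nbr_inv_def)
  qed (fact init)
  have finish: "elim_inv ?R (cs @ [?C]) (eff remove_finish t)"
    if t: "nbr_inv s1 ?R v t" "t POS 0 = offset v + length (adj ! v)" for t
  proof -
    have dn: "nbr_done v t = neighbours E v" using t(2) set_adj[OF vn] by (simp add: nbr_done_def)
    have "v \<notin> neighbours E v" using neighbours_subset[OF E_subset, of v] by blast
    then have CR: "neighbours E v \<inter> ?R = ?C" using vR by (auto simp: neighbours_induced)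
    define c where "c = set_encode ?C"
    have acc: "t ACC 0 = c" using t(1) CR dn by (simp add: nbr_inv_def c_def)
    have tf: "t NUM = s\<^sub>0 NUM" "t OFF = s\<^sub>0 OFF" "t ADJ = s\<^sub>0 ADJ" "t SEEN = s\<^sub>0 SEEN" "t LOW 0 = k"
      "t HEAD = s HEAD" "t KEY = s KEY" "t CNT = s CNT" "t WT = (s WT)(v := 0)"
      using t(1) fr by (simp_all add: nbr_inv_def s1)
    have td: "t DEG u = card (neighbours (induced ?R) u)" if "u \<in> ?R" for u
      using t(1) that deg'[OF that] dn by (simp add: nbr_inv_def s1)
    have tq: "Suc (s HEAD 0) \<le> t TAIL 0" "distinct (map (t QUEUE) [Suc (s HEAD 0)..<t TAIL 0])"
      "set (map (t QUEUE) [Suc (s HEAD 0)..<t TAIL 0]) = {u \<in> ?R. t DEG u = k}"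
      using t(1) by (simp_all add: nbr_inv_def s1)
    define s' where "s' = eff remove_finish t"
    have s': "s' = t(KEY := (t KEY)(s HEAD 0 := c), CNT := (t CNT)(c := Suc (t CNT c)),
        HEAD := (t HEAD)(0 := Suc (s HEAD 0)))"
      using acc tf by (simp add: s'_def remove_finish_def)
    have "k_tree_seq k {0..<n} E ((cs @ [?C]) @ cs')" if "k_tree_seq k ?R (induced ?R) cs'" for cs'
      using seq k_tree_seq_delete_vertex[OF kt big vR vk, of cs'] that
      by (simp add: induced_delete)
    moreover have "card ?R + Suc (s HEAD 0) = n"
      using cR vR finR big by (simp add: card_Diff_singleton)
    moreover have "\<forall>i<Suc (s HEAD 0). s' KEY i = set_encode ((cs @ [?C]) ! i)"
      using cs tf by (auto simp: s' c_def nth_append less_Suc_eq)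
    moreover have "s' CNT = count_list (map set_encode (cs @ [?C]))"
      using cs tf by (auto simp: s' c_def fun_eq_iff)
    moreover have "?R \<subseteq> {0..<n}" using Rn by auto
    moreover have "\<forall>u<n. s' WT u = (if u \<in> ?R then 2 ^ u else 0)" using wt tf by (auto simp: s')
    ultimately show ?thesis
      unfolding elim_inv_def s'_def[symmetric] using kt' tf td tq cs(1) by (auto simp: s')
  qed
  have "runs remove_finish t (ccost remove_finish) (elim_inv ?R (cs @ [?C]))"
    if "nbr_inv s1 ?R v t \<and> t POS 0 = offset v + length (adj ! v)" for t
    using finish[of t] that by (intro runs_loop_free) (auto simp: remove_finish_def)
  note runs_Seq[OF loop this]
  then have "runs (Seq remove_start (Seq remove_loop remove_finish)) s
      (ccost remove_start + ((100 * (offset v + length (adj ! v) - s1 POS 0) + 100) + ccost remove_finish))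
      (elim_inv ?R (cs @ [?C]))"
    by (intro runs_Seq_loop_free) (simp_all add: remove_start_def s1_def)
  then show "runs (Seq remove_start (Seq remove_loop remove_finish)) s (100 * length (adj ! v) + 200)
      (elim_inv ?R (cs @ [?C]))"
    by (rule runs_mono) (simp_all add: s1 remove_start_def remove_finish_def)
qed

text \<open>Amortisation: each present vertex holds the cost of its own removal. Of the 220 units,
  200 cover the fixed part of a removal and 20 the loop test with its control step, which take
  11.\<close>

definition remaining_cost :: "state \<Rightarrow> nat" where
  "remaining_cost s = (\<Sum>v<n. if s WT v = 0 then 0 else 100 * length (adj ! v) + 220)"

lemma remaining_cost_delete:
  assumes "elim_inv R cs s" "elim_inv (R - {v}) cs' s'" "v \<in> R"
  shows "remaining_cost s' + (100 * length (adj ! v) + 220) = remaining_cost s"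
proof -
  have wt: "\<forall>u<n. s WT u = (if u \<in> R then 2 ^ u else 0)" "v < n"
    "\<forall>u<n. s' WT u = (if u \<in> R - {v} then 2 ^ u else 0)"
    using assms by (auto simp: elim_inv_def)
  let ?f = "\<lambda>s u. if s WT u = (0 :: nat) then 0 else 100 * length (adj ! u) + 220"
  have "remaining_cost s = ?f s v + (\<Sum>u\<in>{..<n} - {v}. ?f s u)"
    unfolding remaining_cost_def using wt(2) by (intro sum.remove) auto
  moreover have "remaining_cost s' = ?f s' v + (\<Sum>u\<in>{..<n} - {v}. ?f s' u)"
    unfolding remaining_cost_def using wt(2) by (intro sum.remove) auto
  moreover have "(\<Sum>u\<in>{..<n} - {v}. ?f s' u) = (\<Sum>u\<in>{..<n} - {v}. ?f s u)"
    using wt by (intro sum.cong) auto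
  ultimately show ?thesis using wt assms(3) by simp
qed

definition elim_done :: "nat set list \<Rightarrow> state \<Rightarrow> bool" where
  "elim_done cs s \<longleftrightarrow> k_tree_seq k {0..<n} E cs \<and> length cs \<le> n \<and> s HEAD 0 = length cs \<and> s SEEN = (\<lambda>_. 0) \<and>
     (\<forall>i<length cs. s KEY i = set_encode (cs ! i)) \<and> s CNT = count_list (map set_encode cs)"

lemma eliminate_prog_runs:
  assumes "elim_inv R cs s"
  shows "runs eliminate_prog s (remaining_cost s + 100) (\<lambda>s. \<exists>cs. elim_done cs s)"
proof -
  let ?b = "Less (Plus (get HEAD) (Plus (get LOW) (Const 1))) (get NUM)"
  have "runs eliminate_prog s (remaining_cost s + bcost ?b + 1) (\<lambda>s. (\<exists>R cs. elim_inv R cs s) \<and> \<not> bval ?b s)"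
    unfolding eliminate_prog_def
  proof (rule runs_While)
    show "\<exists>R cs. elim_inv R cs s" using assms by blast
  next
    fix s assume "\<exists>R cs. elim_inv R cs s" and b: "bval ?b s"
    then obtain R cs where inv: "elim_inv R cs s" by blast
    then have lt: "s HEAD 0 + (k + 1) < n" using b by (simp add: elim_inv_def input_num)
    note rem = remove_vertex_runs[OF inv lt]
    show "\<exists>t. runs (Seq remove_start (Seq remove_loop remove_finish)) s t
        (\<lambda>s'. (\<exists>R cs. elim_inv R cs s') \<and> bcost ?b + 1 + t + remaining_cost s' \<le> remaining_cost s)"
    proof (intro exI, rule runs_mono[OF rem(2) order_refl])
      fix s' assume s': "elim_inv (R - {s QUEUE (s HEAD 0)})
        (cs @ [neighbours (induced R) (s QUEUE (s HEAD 0))]) s'"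
      show "(\<exists>R cs. elim_inv R cs s') \<and> bcost ?b + 1 + (100 * length (adj ! s QUEUE (s HEAD 0)) + 200)
          + remaining_cost s' \<le> remaining_cost s"
        using s' remaining_cost_delete[OF inv s' rem(1)] by auto
    qed
  qed
  then show ?thesis
  proof (rule runs_mono)
    fix s assume "(\<exists>R cs. elim_inv R cs s) \<and> \<not> bval ?b s"
    then obtain R cs where inv: "elim_inv R cs s" and "\<not> bval ?b s" by blast
    then have "card R \<le> k + 1" by (simp add: elim_inv_def input_num)
    moreover have kt: "k_tree k R (induced R)" using inv by (simp add: elim_inv_def)
    ultimately have "card R = k + 1" using k_tree_basic(3)[OF kt] by simp
    \<comment> \<open>The test has failed, so at most \<open>k + 1\<close> vertices remain, and a
      \<open>k\<close>-tree has no fewer. The rest is complete and the empty list constructs it,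
      which makes \<open>cs\<close> a construction of the whole graph.\<close>
    then have "k_tree_seq k R (induced R) []"
      using k_tree_minimal_complete[OF kt] k_tree_basic(1)[OF kt] k_tree_seq.complete[of R k] by simp
    then have "k_tree_seq k {0..<n} E cs" using inv unfolding elim_inv_def by (metis append_Nil2)
    then show "\<exists>cs. elim_done cs s"
      using inv by (auto simp: elim_done_def elim_inv_def input_zero intro!: exI[of _ cs])
  qed simp
qed

section \<open>Multiplying the factors\<close>

definition product_inv :: "nat list \<Rightarrow> state \<Rightarrow> bool" where
  "product_inv ks s \<longleftrightarrow> s HEAD 0 = length ks \<and> (\<forall>i<length ks. s KEY i = ks ! i) \<and>
     s CNT = count_list ks \<and> s POS 0 \<le> length ks \<and>
     s SEEN = (\<lambda>x. if x \<in> set (take (s POS 0) ks) then 1 else 0) \<and>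
     s RES 0 = repeat_product ks (s POS 0)"

lemma product_inv_step:
  assumes inv: "product_inv ks s" and lt: "s POS 0 < length ks"
  shows "product_inv ks (eff product_body s) \<and> eff product_body s POS 0 = Suc (s POS 0)"
proof -
  let ?j = "s POS 0" and ?x = "ks ! s POS 0"
  have key: "s KEY ?j = ?x" using inv lt by (simp add: product_inv_def)
  have set': "set (take (Suc ?j) ks) = insert ?x (set (take ?j ks))"
    using lt by (simp add: take_Suc_conv_app_nth)
  show ?thesis
  proof (cases "?x \<in> set (take ?j ks)")
    case True
    have "eff product_body s = s(ACC := (s ACC)(0 := ?x),
        RES := (s RES)(0 := s RES 0 * (s CNT ?x + 1)), POS := (s POS)(0 := Suc ?j))"
      using inv True key by (simp add: product_inv_def product_body_def)
    then show ?thesis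
      using inv True lt repeat_product_Suc[OF lt] set'
      by (auto simp: product_inv_def insert_absorb)
  next
    case False
    have "eff product_body s = s(ACC := (s ACC)(0 := ?x),
        SEEN := (s SEEN)(?x := 1), POS := (s POS)(0 := Suc ?j))"
      using inv False key by (simp add: product_inv_def product_body_def)
    then show ?thesis
      using inv False lt repeat_product_Suc[OF lt] set'
      by (auto simp: product_inv_def fun_eq_iff)
  qed
qed

lemma product_prog_runs:
  assumes s: "elim_done cs s"
  shows "runs product_prog s (100 * n + 200) (\<lambda>s. result s = card (clique_trees {0..<n} E))"
proof -
  define ks where "ks = map set_encode cs"
  have seq: "k_tree_seq k {0..<n} E cs" and len: "length ks \<le> n"
    using s by (auto simp: elim_done_def ks_def)
  \<comment> \<open>\<open>set_encode\<close> is injective on finite sets only; with injectivity,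
    counting codes is counting cliques.\<close>
  have inj: "inj_on set_encode (set cs)"
  proof (rule inj_on_subset[OF inj_on_set_encode])
    have "finite C" if "C \<in> set cs" for C
      using k_tree_seq_attachments[OF seq that] unfolding clique_def
      by (meson finite_atLeastLessThan finite_subset)
    then show "set cs \<subseteq> Collect finite" by blast
  qed
  have "card (clique_trees {0..<n} E)
      = (\<Prod>C\<in>set cs. (count_list cs C + 1) ^ (count_list cs C - 1))"
    by (rule card_clique_trees_k_tree_seq[OF seq k_pos])
  also have "\<dots> = repeat_product ks (length ks)"
    unfolding repeat_product_def ks_def using inj
    by (simp add: prod.reindex count_list_inj_map)
  finally have count: "repeat_product ks (length ks) = card (clique_trees {0..<n} E)" by simp
  define s1 where "s1 = eff (put POS (Const 0)) (eff (put RES (Const 1)) s)"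
  have s1: "product_inv ks s1" "s1 POS 0 = 0"
    using s by (auto simp: s1_def product_inv_def elim_done_def ks_def repeat_product_def)
  have "runs (While (Less (get POS) (get HEAD)) product_body) s1 (100 * (length ks - s1 POS 0) + 100)
      (\<lambda>s. product_inv ks s \<and> s POS 0 = length ks)"
  proof (rule runs_While_loop_free[where I = "product_inv ks"])
    show "loop_free product_body" "ccost product_body + bcost (Less (get POS) (get HEAD)) + 1 \<le> 100"
      by (simp_all add: product_body_def)
  next
    fix s assume s: "product_inv ks s"
    show "product_inv ks (eff product_body s) \<and>
        length ks - eff product_body s POS 0 < length ks - s POS 0"
      if "bval (Less (get POS) (get HEAD)) s"
      using product_inv_step[OF s] s that by (auto simp: product_inv_def)
    show "product_inv ks s \<and> s POS 0 = length ks" if "\<not> bval (Less (get POS) (get HEAD)) s"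
      using s that by (auto simp: product_inv_def)
  qed (fact s1(1))
  then have "runs (seqs [While (Less (get POS) (get HEAD)) product_body]) s1
      ((100 * (length ks - s1 POS 0) + 100) + ccost Skip)
      (\<lambda>s. product_inv ks s \<and> s POS 0 = length ks)"
    unfolding seqs.simps by (rule runs_Seq) (rule runs_loop_free, simp_all)
  then have "runs product_prog s (ccost (put RES (Const 1)) + (ccost (put POS (Const 0)) +
      ((100 * (length ks - s1 POS 0) + 100) + ccost Skip)))
      (\<lambda>s. product_inv ks s \<and> s POS 0 = length ks)"
    unfolding product_prog_def seqs.simps s1_def by (intro runs_Seq_loop_free) simp_all
  then show ?thesis
    by (rule runs_mono) (use s1(2) len count in \<open>auto simp: product_inv_def result_def\<close>)
qed

lemma clique_tree_prog_runs:
  "runs clique_tree_prog s\<^sub>0 (1200 * (n + card E)) (\<lambda>s. result s = card (clique_trees {0..<n} E))"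
proof -
  have elim: "runs eliminate_prog s (200 * card E + 220 * n + 100) (\<lambda>s. \<exists>cs. elim_done cs s)"
    if "ready_inv s \<and> s VTX 0 = n" for s
  proof -
    have "remaining_cost s \<le> (\<Sum>v<n. 100 * card (neighbours E v) + 220)"
      unfolding remaining_cost_def by (intro sum_mono) (simp add: length_adj_nth)
    also have "\<dots> = 100 * (\<Sum>v<n. card (neighbours E v)) + 220 * n"
      by (simp add: sum.distrib sum_distrib_left)
    also have "\<dots> \<le> 200 * card E + 220 * n"
      using sum_degrees_le[OF E_subset] by linarith
    finally have "remaining_cost s + 100 \<le> 200 * card E + 220 * n + 100" by simp
    moreover have "elim_inv {0..<n} [] s" using elim_inv_start[of s] that by blast
    ultimately show ?thesis by (intro runs_mono[OF eliminate_prog_runs])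
  qed
  have "runs clique_tree_prog s\<^sub>0
      ((100 * n + 200) + ((100 * n + 100) + ((200 * card E + 220 * n + 100) + (100 * n + 200))))
      (\<lambda>s. result s = card (clique_trees {0..<n} E))"
    unfolding clique_tree_prog_def
    by (rule runs_Seq[OF degrees_prog_runs], rule runs_Seq[OF queue_prog_runs],
        simp, simp, rule runs_Seq[OF elim], assumption, erule exE, rule product_prog_runs)
  \<comment> \<open>The phases sum to \<open>520 * n + 200 * card E + 600\<close>; since
    \<open>n\<close> is positive, the constant is absorbed by \<open>600 * n\<close>.\<close>
  then show ?thesis by (rule runs_mono) (use n_pos in auto)
qed

end

theorem theorem10:
  shows "\<exists>(p :: com) (c :: nat). \<forall>(k :: nat) (n :: nat) (m :: nat) (V :: nat set) E adj.
    k \<ge> 1 \<longrightarrow> k_tree k V E \<longrightarrow> V = {0..<n} \<longrightarrow> card E = m \<longrightarrow> adjacency_lists n E adj \<longrightarrow>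
    (\<exists>t s. exec p (input_state adj) t s \<and> t \<le> c * (n + m) \<and> result s = card (clique_trees V E))"
proof (rule exI[of _ clique_tree_prog], rule exI[of _ 1200], intro allI impI)
  fix k n m :: nat and V :: "nat set" and E adj
  assume asm: "k \<ge> 1" "k_tree k V E" "V = {0..<n}" "card E = m" "adjacency_lists n E adj"
  then interpret k_tree_input k n E adj by unfold_locales simp_all
  show "\<exists>t s. exec clique_tree_prog (input_state adj) t s \<and> t \<le> 1200 * (n + m) \<and>
      result s = card (clique_trees V E)"
    using clique_tree_prog_runs asm(3,4) by (simp add: runs_def)
qed

end
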